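(* Let $R$ be an arithmetic commutative ring with unity such that its maximal spectrum $\mathrm{Max}\,R$ is Hausdorff and totally disconnected. Then $R$ is an elementary divisor ring. Moreover, for each $a,b\in R$, there exist $d,a',b',c\in R$ such that $a=a'd$, $b=b'd$ and $a'+cb'$ is a unit of $R$.
   Context: $\mathrm{Max}\,R$ is the space of maximal ideals of $R$ with the Zariski topology. A commutative ring is a valuation ring if its set of ideals is totally ordered by inclusion (it need not be a domain). $R$ is arithmetic if $R_P$ is a valuation ring for each maximal ideal $P$. $R$ is an elementary divisor ring if each finitely presented $R$-module is a direct sum of cyclic submodules. *)

theory Defs
  imports "HOL-Analysis.T1_Spaces" "HOL-Algebra.Multiplicative_Group" "HOL-Algebra.Module"
begin

section \<open>The maximal spectrum\<close>

definition Max_spec :: "('a, 'r) ring_scheme \<Rightarrow> 'a set set" where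
  "Max_spec R = {P. maximalideal P R}"

text \<open>The Zariski-closed sets are the sets \<open>V(E) = {P. E \<subseteq> P}\<close> for subsets \<open>E\<close> of \<open>R\<close>;
  the open sets are their complements.\<close>

definition Zariski_open :: "('a, 'r) ring_scheme \<Rightarrow> 'a set set \<Rightarrow> bool" where
  "Zariski_open R U \<longleftrightarrow> (\<exists>E \<subseteq> carrier R. U = Max_spec R - {P \<in> Max_spec R. E \<subseteq> P})"

definition Max_topology :: "('a, 'r) ring_scheme \<Rightarrow> 'a set topology" where
  "Max_topology R = topology (Zariski_open R)"

lemma istopology_Zariski_open:
  assumes "cring R"
  shows "istopology (Zariski_open R)"
proof -
  interpret cring R by fact
  have int: "Zariski_open R (U \<inter> V)" if U: "Zariski_open R U" and V: "Zariski_open R V" for U V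
  proof -
    obtain E where E: "E \<subseteq> carrier R" "U = Max_spec R - {P \<in> Max_spec R. E \<subseteq> P}"
      using U unfolding Zariski_open_def by blast
    obtain F where F: "F \<subseteq> carrier R" "V = Max_spec R - {P \<in> Max_spec R. F \<subseteq> P}"
      using V unfolding Zariski_open_def by blast
    let ?G = "{x \<otimes>\<^bsub>R\<^esub> y | x y. x \<in> E \<and> y \<in> F}"
    have G: "?G \<subseteq> P \<longleftrightarrow> E \<subseteq> P \<or> F \<subseteq> P" if "P \<in> Max_spec R" for P
    proof -
      have "maximalideal P R" using that by (simp add: Max_spec_def)
      then interpret P: primeideal P R by (rule maximalideal_prime)
      show ?thesis
      proof
        assume sub: "?G \<subseteq> P"
        show "E \<subseteq> P \<or> F \<subseteq> P"
        proof (rule ccontr)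
          assume "\<not> (E \<subseteq> P \<or> F \<subseteq> P)"
          then obtain x y where xy: "x \<in> E" "x \<notin> P" "y \<in> F" "y \<notin> P" by blast
          then have "x \<otimes>\<^bsub>R\<^esub> y \<in> P" using sub by blast
          then show False using P.I_prime[of x y] xy E(1) F(1) by blast
        qed
      next
        assume "E \<subseteq> P \<or> F \<subseteq> P"
        then show "?G \<subseteq> P"
        proof
          assume "E \<subseteq> P"
          then show "?G \<subseteq> P" by (auto intro: P.I_r_closed subsetD[OF F(1)])
        next
          assume "F \<subseteq> P"
          then show "?G \<subseteq> P" by (auto intro: P.I_l_closed subsetD[OF E(1)])
        qed
      qed
    qed
    have "?G \<subseteq> carrier R" using E(1) F(1) by auto
    moreover have "U \<inter> V = Max_spec R - {P \<in> Max_spec R. ?G \<subseteq> P}"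
    proof (rule Set.set_eqI)
      fix P
      show "P \<in> U \<inter> V \<longleftrightarrow> P \<in> Max_spec R - {P \<in> Max_spec R. ?G \<subseteq> P}"
        unfolding E(2) F(2) by (cases "P \<in> Max_spec R") (simp_all add: G del: Collect_subset)
    qed
    ultimately show ?thesis unfolding Zariski_open_def by (intro exI[of _ ?G] conjI)
  qed
  have un: "Zariski_open R (\<Union>K)" if K: "\<forall>U\<in>K. Zariski_open R U" for K
  proof -
    have "\<forall>U\<in>K. \<exists>E. E \<subseteq> carrier R \<and> U = Max_spec R - {P \<in> Max_spec R. E \<subseteq> P}"
      using K unfolding Zariski_open_def by simp
    from bchoice[OF this] obtain E where
      E: "\<forall>U\<in>K. E U \<subseteq> carrier R \<and> U = Max_spec R - {P \<in> Max_spec R. E U \<subseteq> P}" ..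
    have mem: "P \<in> U \<longleftrightarrow> P \<in> Max_spec R \<and> \<not> E U \<subseteq> P" if "U \<in> K" for U P
      using eqset_imp_iff[OF conjunct2[OF bspec[OF E that]], of P] by (simp cong: conj_cong)
    have "\<Union>K = Max_spec R - {P \<in> Max_spec R. (\<Union>U\<in>K. E U) \<subseteq> P}"
    proof (rule Set.set_eqI)
      fix P
      have "P \<in> \<Union>K \<longleftrightarrow> (\<exists>U\<in>K. P \<in> Max_spec R \<and> \<not> E U \<subseteq> P)"
        by (simp add: mem cong: bex_cong)
      then show "P \<in> \<Union>K \<longleftrightarrow> P \<in> Max_spec R - {P \<in> Max_spec R. (\<Union>U\<in>K. E U) \<subseteq> P}"
        by (auto simp: UN_subset_iff simp del: Union_iff)
    qed
    moreover have "(\<Union>U\<in>K. E U) \<subseteq> carrier R"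
      by (rule UN_least) (rule conjunct1[OF bspec[OF E]])
    ultimately show ?thesis unfolding Zariski_open_def by (intro exI[of _ "\<Union>U\<in>K. E U"] conjI)
  qed
  show ?thesis unfolding istopology_def by (intro conjI allI impI int un)
qed

lemma openin_Max_topology:
  assumes "cring R"
  shows "openin (Max_topology R) U \<longleftrightarrow> Zariski_open R U"
  by (simp add: Max_topology_def istopology_Zariski_open[OF assms] topology_inverse')

lemma topspace_Max_topology:
  assumes "cring R"
  shows "topspace (Max_topology R) = Max_spec R"
proof -
  interpret cring R by fact
  have "\<not> carrier R \<subseteq> P" if "P \<in> Max_spec R" for P
  proof
    interpret P: maximalideal P R using that by (simp add: Max_spec_def)
    assume "carrier R \<subseteq> P"
    then show False using P.a_subset P.I_notcarr by blast
  qed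
  then have "Max_spec R = Max_spec R - {P \<in> Max_spec R. carrier R \<subseteq> P}" by blast
  then have "Zariski_open R (Max_spec R)" unfolding Zariski_open_def by blast
  moreover have "U \<subseteq> Max_spec R" if "Zariski_open R U" for U
    using that unfolding Zariski_open_def by blast
  ultimately show ?thesis
    unfolding topspace_def openin_Max_topology[OF assms] by blast
qed

definition totally_disconnected_space :: "'a topology \<Rightarrow> bool" where
  "totally_disconnected_space X \<longleftrightarrow>
     (\<forall>C. connectedin X C \<longrightarrow> (\<forall>x\<in>C. \<forall>y\<in>C. x = y))"


section \<open>Localization\<close>

text \<open>The fraction \<open>a / s\<close> is the class of all pairs \<open>(b, t)\<close> with
  \<open>u (a t - b s) = 0\<close> for some \<open>u \<in> S\<close>.\<close>

definition frac_class :: "('a, 'r) ring_scheme \<Rightarrow> 'a set \<Rightarrow> 'a \<Rightarrow> 'a \<Rightarrow> ('a \<times> 'a) set" where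
  "frac_class R S a s =
     {(b, t). b \<in> carrier R \<and> t \<in> S \<and>
        (\<exists>u\<in>S. u \<otimes>\<^bsub>R\<^esub> (a \<otimes>\<^bsub>R\<^esub> t \<ominus>\<^bsub>R\<^esub> b \<otimes>\<^bsub>R\<^esub> s) = \<zero>\<^bsub>R\<^esub>)}"

text \<open>The unions below only run over representatives of the two classes; they do not depend on the
  representative, see \<open>localization_mult\<close> and \<open>localization_add\<close>.\<close>

definition localization :: "('a, 'r) ring_scheme \<Rightarrow> 'a set \<Rightarrow> ('a \<times> 'a) set ring" where
  "localization R S =
     \<lparr>carrier = {frac_class R S a s | a s. a \<in> carrier R \<and> s \<in> S},
      mult = (\<lambda>X Y. \<Union>(a, s)\<in>X. \<Union>(b, t)\<in>Y. frac_class R S (a \<otimes>\<^bsub>R\<^esub> b) (s \<otimes>\<^bsub>R\<^esub> t)),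
      one = frac_class R S \<one>\<^bsub>R\<^esub> \<one>\<^bsub>R\<^esub>,
      zero = frac_class R S \<zero>\<^bsub>R\<^esub> \<one>\<^bsub>R\<^esub>,
      add = (\<lambda>X Y. \<Union>(a, s)\<in>X. \<Union>(b, t)\<in>Y.
               frac_class R S (a \<otimes>\<^bsub>R\<^esub> t \<oplus>\<^bsub>R\<^esub> b \<otimes>\<^bsub>R\<^esub> s) (s \<otimes>\<^bsub>R\<^esub> t))\<rparr>"

definition localization_at :: "('a, 'r) ring_scheme \<Rightarrow> 'a set \<Rightarrow> ('a \<times> 'a) set ring" where
  "localization_at R P = localization R (carrier R - P)"

locale mult_closed_subset = cring R for R (structure) and S +
  assumes S_subset: "S \<subseteq> carrier R"
    and S_one: "\<one> \<in> S"
    and S_mult: "s \<in> S \<Longrightarrow> t \<in> S \<Longrightarrow> s \<otimes> t \<in> S"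
begin

lemma S_carr [simp, intro]: "s \<in> S \<Longrightarrow> s \<in> carrier R"
  using S_subset by blast

lemma frac_rel_iff:
  assumes "a \<in> carrier R" "s \<in> S"
  shows "(b, t) \<in> frac_class R S a s \<longleftrightarrow>
    b \<in> carrier R \<and> t \<in> S \<and> (\<exists>u\<in>S. u \<otimes> (a \<otimes> t) = u \<otimes> (b \<otimes> s))"
proof -
  have "u \<otimes> (a \<otimes> t \<ominus> b \<otimes> s) = \<zero> \<longleftrightarrow> u \<otimes> (a \<otimes> t) = u \<otimes> (b \<otimes> s)"
    if "b \<in> carrier R" "t \<in> S" "u \<in> S" for u
  proof -
    have "u \<otimes> (a \<otimes> t \<ominus> b \<otimes> s) = u \<otimes> (a \<otimes> t) \<ominus> u \<otimes> (b \<otimes> s)"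
      using that assms by (simp add: minus_eq r_distr r_minus)
    then show ?thesis using that assms by (simp add: r_right_minus_eq)
  qed
  then show ?thesis unfolding frac_class_def by blast
qed

lemma frac_rel_refl: "a \<in> carrier R \<Longrightarrow> s \<in> S \<Longrightarrow> (a, s) \<in> frac_class R S a s"
  using S_one by (auto simp: frac_rel_iff)

lemma frac_rel_sym:
  assumes "a \<in> carrier R" "s \<in> S" "(b, t) \<in> frac_class R S a s"
  shows "(a, s) \<in> frac_class R S b t"
proof -
  have bt: "b \<in> carrier R" "t \<in> S" using assms by (auto simp: frac_rel_iff)
  obtain u where "u \<in> S" "u \<otimes> (a \<otimes> t) = u \<otimes> (b \<otimes> s)" using assms by (auto simp: frac_rel_iff)
  then show ?thesis unfolding frac_rel_iff[OF bt] using assms by metis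
qed

lemma frac_rel_trans:
  assumes "a \<in> carrier R" "s \<in> S" "(b, t) \<in> frac_class R S a s" "(c, v) \<in> frac_class R S b t"
  shows "(c, v) \<in> frac_class R S a s"
proof -
  have bt: "b \<in> carrier R" "t \<in> S" using assms by (auto simp: frac_rel_iff)
  have cv: "c \<in> carrier R" "v \<in> S" using assms(4) bt by (auto simp: frac_rel_iff)
  obtain u where u: "u \<in> S" "u \<otimes> (a \<otimes> t) = u \<otimes> (b \<otimes> s)"
    using assms by (auto simp: frac_rel_iff)
  obtain w where w: "w \<in> S" "w \<otimes> (b \<otimes> v) = w \<otimes> (c \<otimes> t)"
    using assms(4) bt by (auto simp: frac_rel_iff)
  have carr: "a \<in> carrier R" "b \<in> carrier R" "c \<in> carrier R" "s \<in> carrier R" "t \<in> carrier R"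
    "u \<in> carrier R" "v \<in> carrier R" "w \<in> carrier R"
    using assms bt cv u w by auto
  have "(u \<otimes> w \<otimes> t) \<otimes> (a \<otimes> v) = (w \<otimes> v) \<otimes> (u \<otimes> (a \<otimes> t))"
    using carr by (simp add: m_ac)
  also have "\<dots> = (u \<otimes> s) \<otimes> (w \<otimes> (b \<otimes> v))" unfolding u(2) using carr by (simp add: m_ac)
  also have "\<dots> = (u \<otimes> w \<otimes> t) \<otimes> (c \<otimes> s)" unfolding w(2) using carr by (simp add: m_ac)
  finally have eq: "(u \<otimes> w \<otimes> t) \<otimes> (a \<otimes> v) = (u \<otimes> w \<otimes> t) \<otimes> (c \<otimes> s)" .
  have "u \<otimes> w \<otimes> t \<in> S" using u w bt S_mult by blast
  with eq show ?thesis unfolding frac_rel_iff[OF assms(1,2)] using cv by blast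
qed

lemma frac_class_eq:
  assumes "a \<in> carrier R" "s \<in> S" "(b, t) \<in> frac_class R S a s"
  shows "frac_class R S b t = frac_class R S a s"
proof -
  have bt: "b \<in> carrier R" "t \<in> S" using assms by (auto simp: frac_rel_iff)
  show ?thesis
    using frac_rel_trans[OF assms] frac_rel_trans[OF bt frac_rel_sym[OF assms]] by auto
qed

lemma frac_class_eqI:
  assumes "a \<in> carrier R" "s \<in> S" "b \<in> carrier R" "t \<in> S" "a \<otimes> t = b \<otimes> s"
  shows "frac_class R S a s = frac_class R S b t"
  using assms S_one by (intro frac_class_eq[symmetric]) (auto simp: frac_rel_iff)

lemma frac_class_cong2:
  assumes "a \<in> carrier R" "s \<in> S" "b \<in> carrier R" "t \<in> S"
    and cong: "\<And>a' s' b' t'. (a', s') \<in> frac_class R S a s \<Longrightarrow> (b', t') \<in> frac_class R S b t \<Longrightarrow>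
      f a' s' b' t' = f a s b t"
  shows "(\<Union>(a', s')\<in>frac_class R S a s. \<Union>(b', t')\<in>frac_class R S b t. f a' s' b' t') = f a s b t"
proof -
  note refl = frac_rel_refl[OF assms(1,2)] frac_rel_refl[OF assms(3,4)]
  show ?thesis
  proof (intro equalityI subsetI)
    fix z assume "z \<in> f a s b t"
    then show "z \<in> (\<Union>(a', s')\<in>frac_class R S a s. \<Union>(b', t')\<in>frac_class R S b t. f a' s' b' t')"
      using refl by blast
  qed (use cong in blast)
qed

lemma localization_mult:
  assumes "a \<in> carrier R" "s \<in> S" "b \<in> carrier R" "t \<in> S"
  shows "frac_class R S a s \<otimes>\<^bsub>localization R S\<^esub> frac_class R S b t = frac_class R S (a \<otimes> b) (s \<otimes> t)"
proof -
  have "frac_class R S (a' \<otimes> b') (s' \<otimes> t') = frac_class R S (a \<otimes> b) (s \<otimes> t)"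
    if A: "(a', s') \<in> frac_class R S a s" and B: "(b', t') \<in> frac_class R S b t" for a' s' b' t'
  proof (rule frac_class_eq)
    have a': "a' \<in> carrier R" "s' \<in> S" "b' \<in> carrier R" "t' \<in> S"
      using A B assms by (auto simp: frac_rel_iff)
    obtain u where u: "u \<in> S" "u \<otimes> (a \<otimes> s') = u \<otimes> (a' \<otimes> s)"
      using A assms by (auto simp: frac_rel_iff)
    obtain w where w: "w \<in> S" "w \<otimes> (b \<otimes> t') = w \<otimes> (b' \<otimes> t)"
      using B assms by (auto simp: frac_rel_iff)
    have carr: "s \<in> carrier R" "t \<in> carrier R" "s' \<in> carrier R" "t' \<in> carrier R"
      "u \<in> carrier R" "w \<in> carrier R" using a' u w assms by auto
    have "(u \<otimes> w) \<otimes> ((a \<otimes> b) \<otimes> (s' \<otimes> t')) = (u \<otimes> (a \<otimes> s')) \<otimes> (w \<otimes> (b \<otimes> t'))"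
      using assms a' carr by (simp add: m_ac)
    also have "\<dots> = (u \<otimes> w) \<otimes> ((a' \<otimes> b') \<otimes> (s \<otimes> t))"
      unfolding u(2) w(2) using assms a' carr by (simp add: m_ac)
    finally show "(a' \<otimes> b', s' \<otimes> t') \<in> frac_class R S (a \<otimes> b) (s \<otimes> t)"
      using assms a' u(1) w(1) S_mult by (subst frac_rel_iff) auto
  qed (use assms S_mult in auto)
  from frac_class_cong2[OF assms, of "\<lambda>a s b t. frac_class R S (a \<otimes> b) (s \<otimes> t)", OF this]
  show ?thesis by (simp add: localization_def)
qed

lemma localization_add:
  assumes "a \<in> carrier R" "s \<in> S" "b \<in> carrier R" "t \<in> S"
  shows "frac_class R S a s \<oplus>\<^bsub>localization R S\<^esub> frac_class R S b t =
    frac_class R S (a \<otimes> t \<oplus> b \<otimes> s) (s \<otimes> t)"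
proof -
  have "frac_class R S (a' \<otimes> t' \<oplus> b' \<otimes> s') (s' \<otimes> t') = frac_class R S (a \<otimes> t \<oplus> b \<otimes> s) (s \<otimes> t)"
    if A: "(a', s') \<in> frac_class R S a s" and B: "(b', t') \<in> frac_class R S b t" for a' s' b' t'
  proof (rule frac_class_eq)
    have a': "a' \<in> carrier R" "s' \<in> S" "b' \<in> carrier R" "t' \<in> S"
      using A B assms by (auto simp: frac_rel_iff)
    obtain u where u: "u \<in> S" "u \<otimes> (a \<otimes> s') = u \<otimes> (a' \<otimes> s)"
      using A assms by (auto simp: frac_rel_iff)
    obtain w where w: "w \<in> S" "w \<otimes> (b \<otimes> t') = w \<otimes> (b' \<otimes> t)"
      using B assms by (auto simp: frac_rel_iff)
    have carr: "s \<in> carrier R" "t \<in> carrier R" "s' \<in> carrier R" "t' \<in> carrier R"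
      "u \<in> carrier R" "w \<in> carrier R" using a' u w assms by auto
    have "(u \<otimes> w) \<otimes> ((a \<otimes> t \<oplus> b \<otimes> s) \<otimes> (s' \<otimes> t')) =
        (w \<otimes> t \<otimes> t') \<otimes> (u \<otimes> (a \<otimes> s')) \<oplus> (u \<otimes> s \<otimes> s') \<otimes> (w \<otimes> (b \<otimes> t'))"
      using assms a' carr by (simp add: m_ac r_distr l_distr)
    also have "\<dots> = (u \<otimes> w) \<otimes> ((a' \<otimes> t' \<oplus> b' \<otimes> s') \<otimes> (s \<otimes> t))"
      unfolding u(2) w(2) using assms a' carr by (simp add: m_ac r_distr l_distr)
    finally show "(a' \<otimes> t' \<oplus> b' \<otimes> s', s' \<otimes> t') \<in> frac_class R S (a \<otimes> t \<oplus> b \<otimes> s) (s \<otimes> t)"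
      using assms a' u(1) w(1) S_mult by (subst frac_rel_iff) auto
  qed (use assms S_mult in auto)
  from frac_class_cong2[OF assms,
      of "\<lambda>a s b t. frac_class R S (a \<otimes> t \<oplus> b \<otimes> s) (s \<otimes> t)", OF this]
  show ?thesis by (simp add: localization_def)
qed

lemma localization_carrier:
  "carrier (localization R S) = {frac_class R S a s | a s. a \<in> carrier R \<and> s \<in> S}"
  by (simp add: localization_def)

lemma localization_one: "\<one>\<^bsub>localization R S\<^esub> = frac_class R S \<one> \<one>"
  by (simp add: localization_def)

lemma localization_zero: "\<zero>\<^bsub>localization R S\<^esub> = frac_class R S \<zero> \<one>"
  by (simp add: localization_def)

lemmas localization_simps =
  localization_carrier localization_one localization_zero localization_mult localization_add

lemma localization_cases:
  assumes "x \<in> carrier (localization R S)"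
  obtains a s where "x = frac_class R S a s" "a \<in> carrier R" "s \<in> S"
  using assms by (auto simp: localization_carrier)

lemma frac_class_carrier:
  "a \<in> carrier R \<Longrightarrow> s \<in> S \<Longrightarrow> frac_class R S a s \<in> carrier (localization R S)"
  by (auto simp: localization_carrier)

lemma cring_localization: "cring (localization R S)"
proof -
  let ?L = "localization R S"
  note simps = localization_one localization_zero localization_mult localization_add S_one S_mult
  have add_closed: "x \<oplus>\<^bsub>?L\<^esub> y \<in> carrier ?L"
    if "x \<in> carrier ?L" "y \<in> carrier ?L" for x y
    by (rule localization_cases[OF that(1)], rule localization_cases[OF that(2)])
      (simp add: simps frac_class_carrier)
  have mult_closed: "x \<otimes>\<^bsub>?L\<^esub> y \<in> carrier ?L"
    if "x \<in> carrier ?L" "y \<in> carrier ?L" for x y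
    by (rule localization_cases[OF that(1)], rule localization_cases[OF that(2)])
      (simp add: simps frac_class_carrier)
  have zero: "\<zero>\<^bsub>?L\<^esub> \<in> carrier ?L" and one: "\<one>\<^bsub>?L\<^esub> \<in> carrier ?L"
    by (simp_all add: simps frac_class_carrier)
  have add_assoc: "x \<oplus>\<^bsub>?L\<^esub> y \<oplus>\<^bsub>?L\<^esub> z = x \<oplus>\<^bsub>?L\<^esub> (y \<oplus>\<^bsub>?L\<^esub> z)"
    if "x \<in> carrier ?L" "y \<in> carrier ?L" "z \<in> carrier ?L" for x y z
    by (rule localization_cases[OF that(1)], rule localization_cases[OF that(2)],
        rule localization_cases[OF that(3)])
      (simp add: simps, rule frac_class_eqI, simp_all add: simps m_ac a_ac l_distr r_distr)
  have add_comm: "x \<oplus>\<^bsub>?L\<^esub> y = y \<oplus>\<^bsub>?L\<^esub> x"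
    if "x \<in> carrier ?L" "y \<in> carrier ?L" for x y
    by (rule localization_cases[OF that(1)], rule localization_cases[OF that(2)])
      (simp add: simps, rule frac_class_eqI, simp_all add: simps m_ac a_ac l_distr r_distr)
  have add_zero: "\<zero>\<^bsub>?L\<^esub> \<oplus>\<^bsub>?L\<^esub> x = x" if "x \<in> carrier ?L" for x
    by (rule localization_cases[OF that]) (simp add: simps)
  have add_inv: "\<exists>y\<in>carrier ?L. y \<oplus>\<^bsub>?L\<^esub> x = \<zero>\<^bsub>?L\<^esub>" if asm: "x \<in> carrier ?L" for x
  proof -
    obtain a s where x: "x = frac_class R S a s" "a \<in> carrier R" "s \<in> S"
      by (rule localization_cases[OF asm])
    have "frac_class R S (\<ominus> a) s \<oplus>\<^bsub>?L\<^esub> x = frac_class R S (\<ominus> a \<otimes> s \<oplus> a \<otimes> s) (s \<otimes> s)"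
      using x by (simp add: localization_add)
    also have "\<dots> = \<zero>\<^bsub>?L\<^esub>"
      unfolding localization_zero using x S_one S_mult
      by (intro frac_class_eqI) (simp_all add: l_minus l_neg)
    finally show ?thesis using x frac_class_carrier[of "\<ominus> a" s] by auto
  qed
  have mult_assoc: "x \<otimes>\<^bsub>?L\<^esub> y \<otimes>\<^bsub>?L\<^esub> z = x \<otimes>\<^bsub>?L\<^esub> (y \<otimes>\<^bsub>?L\<^esub> z)"
    if "x \<in> carrier ?L" "y \<in> carrier ?L" "z \<in> carrier ?L" for x y z
    by (rule localization_cases[OF that(1)], rule localization_cases[OF that(2)],
        rule localization_cases[OF that(3)]) (simp add: simps m_assoc)
  have mult_comm: "x \<otimes>\<^bsub>?L\<^esub> y = y \<otimes>\<^bsub>?L\<^esub> x"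
    if "x \<in> carrier ?L" "y \<in> carrier ?L" for x y
    by (rule localization_cases[OF that(1)], rule localization_cases[OF that(2)])
      (simp add: simps m_comm)
  have mult_one: "\<one>\<^bsub>?L\<^esub> \<otimes>\<^bsub>?L\<^esub> x = x" if "x \<in> carrier ?L" for x
    by (rule localization_cases[OF that]) (simp add: simps)
  have distr: "(x \<oplus>\<^bsub>?L\<^esub> y) \<otimes>\<^bsub>?L\<^esub> z = x \<otimes>\<^bsub>?L\<^esub> z \<oplus>\<^bsub>?L\<^esub> y \<otimes>\<^bsub>?L\<^esub> z"
    if "x \<in> carrier ?L" "y \<in> carrier ?L" "z \<in> carrier ?L" for x y z
    by (rule localization_cases[OF that(1)], rule localization_cases[OF that(2)],
        rule localization_cases[OF that(3)])
      (simp add: simps, rule frac_class_eqI, simp_all add: simps m_ac a_ac l_distr r_distr)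
  have "abelian_group ?L"
    by (rule abelian_groupI; fact add_closed zero add_assoc add_comm add_zero add_inv)
  moreover have "comm_monoid ?L"
    by (rule comm_monoidI; fact mult_closed one mult_assoc mult_comm mult_one)
  ultimately show ?thesis
    by (rule cringI) (fact distr)
qed

end

lemma mult_closed_subset_maximalideal:
  assumes "cring R" "maximalideal P R"
  shows "mult_closed_subset R (carrier R - P)"
proof -
  interpret cring R by fact
  interpret P: primeideal P R by (rule maximalideal_prime) fact
  show ?thesis
    by unfold_locales (use P.I_prime P.one_imp_carrier P.I_notcarr in auto)
qed

lemma cring_localization_at:
  assumes "cring R" "maximalideal P R"
  shows "cring (localization_at R P)"
  unfolding localization_at_def
  by (rule mult_closed_subset.cring_localization[OF mult_closed_subset_maximalideal[OF assms]])


section \<open>Valuation rings and arithmetic rings\<close>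

definition valuation_ring :: "('a, 'r) ring_scheme \<Rightarrow> bool" where
  "valuation_ring R \<longleftrightarrow> cring R \<and> (\<forall>I J. ideal I R \<and> ideal J R \<longrightarrow> I \<subseteq> J \<or> J \<subseteq> I)"

definition arithmetic_ring :: "('a, 'r) ring_scheme \<Rightarrow> bool" where
  "arithmetic_ring R \<longleftrightarrow>
     cring R \<and> (\<forall>P. maximalideal P R \<longrightarrow> valuation_ring (localization_at R P))"


section \<open>Finitely presented modules and elementary divisor rings\<close>

definition submodule_span ::
    "('a, 'r) ring_scheme \<Rightarrow> ('a, 'm, 'x) module_scheme \<Rightarrow> 'm set \<Rightarrow> 'm set" where
  "submodule_span R M X = \<Inter> {N. submodule N R M \<and> X \<subseteq> N}"

definition fin_gen_submodule ::
    "('a, 'r) ring_scheme \<Rightarrow> ('a, 'm, 'x) module_scheme \<Rightarrow> 'm set \<Rightarrow> bool" where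
  "fin_gen_submodule R M N \<longleftrightarrow> (\<exists>X. finite X \<and> X \<subseteq> carrier M \<and> N = submodule_span R M X)"

definition cyclic_submodule ::
    "('a, 'r) ring_scheme \<Rightarrow> ('a, 'm, 'x) module_scheme \<Rightarrow> 'm set \<Rightarrow> bool" where
  "cyclic_submodule R M N \<longleftrightarrow> (\<exists>x\<in>carrier M. N = submodule_span R M {x})"

definition linear_maps ::
    "('a, 'r) ring_scheme \<Rightarrow> ('a, 'm, 'x) module_scheme \<Rightarrow> ('a, 'n, 'y) module_scheme \<Rightarrow> ('m \<Rightarrow> 'n) set"
where
  "linear_maps R M N = {f \<in> carrier M \<rightarrow> carrier N.
     (\<forall>x\<in>carrier M. \<forall>y\<in>carrier M. f (x \<oplus>\<^bsub>M\<^esub> y) = f x \<oplus>\<^bsub>N\<^esub> f y) \<and>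
     (\<forall>r\<in>carrier R. \<forall>x\<in>carrier M. f (r \<odot>\<^bsub>M\<^esub> x) = r \<odot>\<^bsub>N\<^esub> f x)}"

text \<open>The free module \<open>R\<^sup>n\<close>. Records of modules extend records of rings, so the fields \<open>mult\<close> and
  \<open>one\<close> have to be given too; they play no role in the module structure.\<close>

definition free_module :: "('a, 'r) ring_scheme \<Rightarrow> nat \<Rightarrow> ('a, nat \<Rightarrow> 'a) module" where
  "free_module R n =
     \<lparr>carrier = (\<Pi>\<^sub>E i\<in>{..<n}. carrier R),
      mult = (\<lambda>v w. \<lambda>i\<in>{..<n}. v i \<otimes>\<^bsub>R\<^esub> w i),
      one = (\<lambda>i\<in>{..<n}. \<one>\<^bsub>R\<^esub>),
      zero = (\<lambda>i\<in>{..<n}. \<zero>\<^bsub>R\<^esub>),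
      add = (\<lambda>v w. \<lambda>i\<in>{..<n}. v i \<oplus>\<^bsub>R\<^esub> w i),
      smult = (\<lambda>r v. \<lambda>i\<in>{..<n}. r \<otimes>\<^bsub>R\<^esub> v i)\<rparr>"

lemma module_free_module:
  assumes "cring R"
  shows "module R (free_module R n)"
proof -
  interpret cring R by fact
  have mem: "v \<in> carrier (free_module R n) \<Longrightarrow> i < n \<Longrightarrow> v i \<in> carrier R" for v i
    by (auto simp: free_module_def)
  have ext: "v = w" if "v \<in> carrier (free_module R n)" "w \<in> carrier (free_module R n)"
    "\<And>i. i < n \<Longrightarrow> v i = w i" for v w
    using that by (intro PiE_ext[of v "{..<n}" "\<lambda>_. carrier R" w]) (auto simp: free_module_def)
  have add: "(v \<oplus>\<^bsub>free_module R n\<^esub> w) i = v i \<oplus>\<^bsub>R\<^esub> w i" if "i < n" for v w i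
    using that by (simp add: free_module_def)
  have zero: "\<zero>\<^bsub>free_module R n\<^esub> i = \<zero>\<^bsub>R\<^esub>" if "i < n" for i
    using that by (simp add: free_module_def)
  have smult: "(r \<odot>\<^bsub>free_module R n\<^esub> v) i = r \<otimes>\<^bsub>R\<^esub> v i" if "i < n" for r v i
    using that by (simp add: free_module_def)
  have add_closed: "v \<oplus>\<^bsub>free_module R n\<^esub> w \<in> carrier (free_module R n)"
    if "v \<in> carrier (free_module R n)" "w \<in> carrier (free_module R n)" for v w
    using mem[OF that(1)] mem[OF that(2)] by (simp add: free_module_def)
  have smult_closed: "r \<odot>\<^bsub>free_module R n\<^esub> v \<in> carrier (free_module R n)"
    if "r \<in> carrier R" "v \<in> carrier (free_module R n)" for r v
    using that(1) mem[OF that(2)] by (simp add: free_module_def)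
  have zero_closed: "\<zero>\<^bsub>free_module R n\<^esub> \<in> carrier (free_module R n)"
    by (simp add: free_module_def)
  note closed = add_closed smult_closed zero_closed
  note eval = mem add zero smult
  show ?thesis
  proof (rule moduleI)
    show "abelian_group (free_module R n)"
    proof (rule abelian_groupI)
      fix x assume x: "x \<in> carrier (free_module R n)"
      let ?y = "\<lambda>i\<in>{..<n}. \<ominus>\<^bsub>R\<^esub> x i"
      have "?y \<in> carrier (free_module R n)" using mem[OF x] by (simp add: free_module_def)
      moreover have "?y \<oplus>\<^bsub>free_module R n\<^esub> x = \<zero>\<^bsub>free_module R n\<^esub>"
        using calculation x by (intro ext) (simp_all add: closed eval l_neg)
      ultimately show "\<exists>y\<in>carrier (free_module R n). y \<oplus>\<^bsub>free_module R n\<^esub> x = \<zero>\<^bsub>free_module R n\<^esub>"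
        by blast
    qed (simp_all add: closed, (rule ext; simp add: closed eval a_ac)+)
  qed (simp_all add: closed \<open>cring R\<close>, (rule ext; simp add: closed eval l_distr r_distr m_assoc)+)
qed

definition finitely_presented ::
    "('a, 'r) ring_scheme \<Rightarrow> ('a, 'm, 'x) module_scheme \<Rightarrow> bool" where
  "finitely_presented R M \<longleftrightarrow> module R M \<and>
     (\<exists>n. \<exists>f \<in> linear_maps R (free_module R n) M.
        f ` carrier (free_module R n) = carrier M \<and>
        fin_gen_submodule R (free_module R n) {v \<in> carrier (free_module R n). f v = \<zero>\<^bsub>M\<^esub>})"

text \<open>\<open>M\<close> is the internal direct sum of the set \<open>\<C>\<close> of submodules: every element of \<open>M\<close> is, in a
  unique way, the sum of a finitely supported family of elements of the members of \<open>\<C>\<close>.\<close>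

definition is_direct_sum ::
    "('a, 'r) ring_scheme \<Rightarrow> ('a, 'm, 'x) module_scheme \<Rightarrow> 'm set set \<Rightarrow> bool" where
  "is_direct_sum R M \<C> \<longleftrightarrow>
     (\<forall>N\<in>\<C>. submodule N R M) \<and>
     (\<forall>x\<in>carrier M. \<exists>!f. f \<in> (\<Pi>\<^sub>E N\<in>\<C>. N) \<and> finite {N \<in> \<C>. f N \<noteq> \<zero>\<^bsub>M\<^esub>} \<and>
        x = (\<Oplus>\<^bsub>M\<^esub>N\<in>{N \<in> \<C>. f N \<noteq> \<zero>\<^bsub>M\<^esub>}. f N))"

text \<open>HOL cannot quantify over all types inside a formula, so the type \<open>'m\<close> of the elements of the
  modules is a parameter; a theorem with a free type variable \<open>'m\<close> covers all modules.\<close>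

definition elementary_divisor_ring :: "'m itself \<Rightarrow> ('a, 'r) ring_scheme \<Rightarrow> bool" where
  "elementary_divisor_ring (_ :: 'm itself) R \<longleftrightarrow> cring R \<and>
     (\<forall>M :: ('a, 'm) module. finitely_presented R M \<longrightarrow>
        (\<exists>\<C>. (\<forall>N\<in>\<C>. cyclic_submodule R M N) \<and> is_direct_sum R M \<C>))"

end

theory Submission
  imports Defs "HOL-Algebra.Ring_Divisibility" "HOL-Analysis.Abstract_Topological_Spaces"
begin

text \<open>Since \<open>R\<close> is arithmetic, each maximal ideal lies in the open set where \<open>a\<close> is locally a multiple of
  \<open>b\<close> or in the one where \<open>b\<close> is locally a multiple of \<open>a\<close>. As \<open>Max R\<close> is compact, Hausdorff and totally
  disconnected, a clopen set \<open>W\<close> chooses between the two; it is cut out by some \<open>1 = u + e\<close> with \<open>u\<close> in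
  the members of \<open>W\<close> and \<open>e\<close> in the other maximal ideals. Then \<open>d = e b + u a\<close> generates \<open>(a, b)\<close>, and
  its cofactors can be corrected by multiples of \<open>1 - e b' - u a'\<close>, which annihilates \<open>d\<close>, so that
  some \<open>a' + c b'\<close> lies outside all maximal ideals. In particular \<open>a + c b\<close> generates \<open>(a, b)\<close>.
  This property alone makes every matrix diagonalizable by adding multiples of rows and columns to
  others: in the triangular case with entries \<open>a, b\<close> over \<open>0, c\<close>, one addition of rows and one of
  columns turn the corner entry into \<open>a + l (b + k c)\<close>, which can be made a generator of \<open>(a, b, c)\<close>.\<close>

section \<open>Maximal ideals and clopen sets\<close>

context cring
begin

text \<open>Zorn's lemma applies to the proper ideals above \<open>I\<close>: properness means that
  \<one> is missing, which survives unions of chains.\<close>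

lemma exists_maximalideal:
  assumes "ideal I R" "I \<noteq> carrier R"
  obtains P where "maximalideal P R" "I \<subseteq> P"
proof -
  let ?A = "{J. ideal J R \<and> I \<subseteq> J \<and> J \<noteq> carrier R}"
  have one_notin: "\<one> \<notin> J" if "J \<in> ?A" for J
    using that ideal.one_imp_carrier by blast
  have "\<Union>C \<in> ?A" if C: "C \<noteq> {}" "subset.chain ?A C" for C
  proof -
    have sub: "C \<subseteq> ?A" using C(2) by (simp add: subset.chain_def)
    then have "subset.chain {J. ideal J R} C"
      using C(2) unfolding subset.chain_def by blast
    then have "ideal (\<Union>C) R" using chain_Union_is_ideal[of C] C(1) by simp
    moreover have "\<one> \<notin> \<Union>C" using one_notin sub by blast
    ultimately show ?thesis using C(1) sub one_closed by blast
  qed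
  then have "\<exists>P\<in>?A. \<forall>J\<in>?A. P \<subseteq> J \<longrightarrow> J = P"
    by (intro subset_Zorn_nonempty) (use assms in auto)
  then obtain P where P: "P \<in> ?A" "\<forall>J\<in>?A. P \<subseteq> J \<longrightarrow> J = P" ..
  have "maximalideal P R"
  proof (rule maximalidealI)
    show "J = P \<or> J = carrier R" if "ideal J R" "P \<subseteq> J" for J
      using P that order_trans[of I P J] by blast
  qed (use P(1) in auto)
  then show thesis using that P(1) by blast
qed

text \<open>The local-to-global principle used below: once the elements with some property form an
  ideal, it suffices to find one of them outside each maximal ideal.\<close>

lemma ideal_eq_carrierI:
  assumes "ideal I R" "\<And>P. maximalideal P R \<Longrightarrow> \<not> I \<subseteq> P"
  shows "I = carrier R"
  using assms exists_maximalideal by metis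

lemma UnitsI_maximalideal:
  assumes x: "x \<in> carrier R" and "\<And>P. maximalideal P R \<Longrightarrow> x \<notin> P"
  shows "x \<in> Units R"
proof -
  have "PIdl x = carrier R"
    using assms cgenideal_self by (intro ideal_eq_carrierI cgenideal_ideal) blast+
  then have "\<one> \<in> PIdl x" by simp
  then obtain y where "y \<in> carrier R" "\<one> = y \<otimes> x"
    by (auto simp: cgenideal_def)
  then show ?thesis using x m_comm[of x y] by (auto simp: Units_def)
qed

lemma in_maximalideal_imp_one_minus_notin:
  assumes "maximalideal P R" "x \<in> P"
  shows "\<one> \<ominus> x \<notin> P"
proof
  interpret P: maximalideal P R by fact
  assume "\<one> \<ominus> x \<in> P"
  then have "(\<one> \<ominus> x) \<oplus> x \<in> P" using assms(2) by (rule P.a_closed)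
  moreover have "x \<in> carrier R" using assms(2) by (rule P.Icarr)
  then have "(\<one> \<ominus> x) \<oplus> x = \<one>" by algebra
  ultimately show False using P.one_imp_carrier P.I_notcarr by simp
qed

section \<open>Quasi-compactness of the maximal spectrum\<close>

text \<open>The elements whose basic open set is covered by finitely many members of the cover form an
  ideal.\<close>

lemma compact_space_Max_topology: "compact_space (Max_topology R)"
  unfolding compact_space_alt
proof (intro allI impI)
  note openin_iff = openin_Max_topology[OF is_cring]
  note topspace = topspace_Max_topology[OF is_cring]
  fix \<U> assume \<U>: "(\<forall>U\<in>\<U>. openin (Max_topology R) U) \<and> topspace (Max_topology R) \<subseteq> \<Union>\<U>"
  define covers where "covers \<F> x \<longleftrightarrow> finite \<F> \<and> \<F> \<subseteq> \<U> \<and> (\<forall>P\<in>Max_spec R. x \<notin> P \<longrightarrow> P \<in> \<Union>\<F>)"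
    for \<F> x
  define J where "J = {x \<in> carrier R. \<exists>\<F>. covers \<F> x}"
  have J_I: "x \<in> J" if "x \<in> carrier R" "covers \<F> x" for x \<F>
    using that by (auto simp: J_def)
  have J_E: "\<exists>\<F>. covers \<F> x" if "x \<in> J" for x
    using that by (simp add: J_def)
  have J_carr: "x \<in> carrier R" if "x \<in> J" for x
    using that by (simp add: J_def)
  have ideal_spec: "ideal P R" if "P \<in> Max_spec R" for P
    using that by (simp add: Max_spec_def maximalideal.axioms(1))
  have mult: "y \<otimes> x \<in> J" if x: "x \<in> J" and y: "y \<in> carrier R" for x y
  proof -
    obtain \<F> where "covers \<F> x" using J_E[OF x] ..
    \<comment> \<open>A maximal ideal that misses \<open>y \<otimes> x\<close> also misses
      \<open>x\<close>, so the same subfamily works.\<close>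
    then have "covers \<F> (y \<otimes> x)"
      unfolding covers_def using ideal.I_l_closed[OF ideal_spec _ y] by blast
    then show ?thesis using J_I J_carr[OF x] y by simp
  qed
  have add: "x \<oplus> y \<in> J" if x: "x \<in> J" and y: "y \<in> J" for x y
  proof -
    obtain \<F> where \<F>: "covers \<F> x" using J_E[OF x] ..
    obtain \<G> where \<G>: "covers \<G> y" using J_E[OF y] ..
    have "P \<in> \<Union>(\<F> \<union> \<G>)" if P: "P \<in> Max_spec R" and "x \<oplus> y \<notin> P" for P
    proof -
      have "x \<notin> P \<or> y \<notin> P"
        using that(2) additive_subgroup.a_closed[OF ideal.axioms(1)[OF ideal_spec[OF P]]] by metis
      then show ?thesis using \<F> \<G> P unfolding covers_def by (metis Un_iff Union_Un_distrib)
    qed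
    then have "covers (\<F> \<union> \<G>) (x \<oplus> y)"
      using \<F> \<G> unfolding covers_def by (simp del: Union_Un_distrib)
    then show ?thesis using J_I J_carr[OF x] J_carr[OF y] by simp
  qed
  have "ideal J R"
  proof (rule idealI)
    show "subgroup J (add_monoid R)"
    proof (rule add.subgroupI)
      have "covers {} \<zero>"
        using additive_subgroup.zero_closed[OF ideal.axioms(1)[OF ideal_spec]]
        by (simp add: covers_def)
      then show "J \<noteq> {}" using J_I[OF zero_closed] by blast
      show "\<ominus> x \<in> J" if "x \<in> J" for x
        using mult[OF that, of "\<ominus> \<one>"] J_carr[OF that] by (simp add: l_minus)
    qed (use J_carr add in auto)
    show "x \<otimes> y \<in> J" if "x \<in> J" "y \<in> carrier R" for x y
      using mult[OF that] that J_carr m_comm[of x y] by simp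
  qed (fact ring_axioms mult)+
  moreover have "\<not> J \<subseteq> P" if "maximalideal P R" for P
  proof -
    have P: "P \<in> Max_spec R" using that by (simp add: Max_spec_def)
    then obtain U where U: "U \<in> \<U>" "P \<in> U" using \<U> topspace by blast
    then have "Zariski_open R U" using \<U> openin_iff by simp
    then obtain E where E: "E \<subseteq> carrier R" "U = Max_spec R - {P \<in> Max_spec R. E \<subseteq> P}"
      unfolding Zariski_open_def by blast
    \<comment> \<open>The basic open set of \<open>x\<close> is a neighbourhood of \<open>P\<close>
      inside \<open>U\<close>, so the single member \<open>U\<close> covers it.\<close>
    then obtain x where x: "x \<in> E" "x \<notin> P" using U(2) by blast
    then have "covers {U} x" using E(2) U(1) by (auto simp: covers_def)
    then have "x \<in> J" using J_I E(1) x(1) by blast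
    with x(2) show ?thesis by blast
  qed
  ultimately have "J = carrier R" by (rule ideal_eq_carrierI)
  then have "\<one> \<in> J" by simp
  then obtain \<F> where \<F>: "covers \<F> \<one>" using J_E by blast
  have "\<one> \<notin> P" if "P \<in> Max_spec R" for P
    using that ideal.one_imp_carrier[OF ideal_spec[OF that]] maximalideal.I_notcarr[of P R]
    by (auto simp: Max_spec_def)
  then have "topspace (Max_topology R) \<subseteq> \<Union>\<F>" using \<F> topspace by (auto simp: covers_def)
  then show "\<exists>\<F>. finite \<F> \<and> \<F> \<subseteq> \<U> \<and> topspace (Max_topology R) \<subseteq> \<Union>\<F>"
    using \<F> by (auto simp: covers_def)
qed

section \<open>Clopen sets and decompositions of the unit element\<close>

text \<open>The intersection of the members of \<open>W\<close> and that of the other maximal ideals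
  are comaximal: since \<open>W\<close> and its complement are both open, no maximal ideal lies
  above both intersections.\<close>

lemma clopen_imp_comaximal_split:
  assumes "openin (Max_topology R) W" "closedin (Max_topology R) W"
  obtains e u where "e \<in> carrier R" "u \<in> carrier R" "u \<oplus> e = \<one>"
    "\<And>P. maximalideal P R \<Longrightarrow> P \<in> W \<Longrightarrow> u \<in> P"
    "\<And>P. maximalideal P R \<Longrightarrow> P \<notin> W \<Longrightarrow> e \<in> P"
proof -
  note openin_iff = openin_Max_topology[OF is_cring]
  note topspace = topspace_Max_topology[OF is_cring]
  obtain E where E: "E \<subseteq> carrier R" "W = Max_spec R - {P \<in> Max_spec R. E \<subseteq> P}"
    using assms(1) unfolding openin_iff Zariski_open_def by blast
  obtain F where F: "F \<subseteq> carrier R" "Max_spec R - W = Max_spec R - {P \<in> Max_spec R. F \<subseteq> P}"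
    using assms(2) unfolding closedin_def openin_iff topspace Zariski_open_def by blast
  \<comment> \<open>Inserting \<open>carrier R\<close> keeps the intersection inside the ring when
    \<open>V\<close> contains no maximal ideal.\<close>
  define I where "I = (\<lambda>V. \<Inter>P\<in>insert (carrier R) (Max_spec R \<inter> V). P)"
  have I: "ideal (I V) R" for V
    unfolding I_def
    using i_Intersect[of "insert (carrier R) (Max_spec R \<inter> V)"] oneideal
    by (auto simp: Max_spec_def intro: maximalideal.axioms(1))
  have "I W <+> I (- W) = carrier R"
  proof (rule ideal_eq_carrierI)
    show "ideal (I W <+> I (- W)) R" by (intro add_ideals I)
    fix P assume P: "maximalideal P R"
    have sub: "I W \<subseteq> I W <+> I (- W)" "I (- W) \<subseteq> I W <+> I (- W)"
      using union_genideal[OF I I, of W "- W"] genideal_self[of "I W \<union> I (- W)"]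
        ideal.Icarr[OF I] by blast+
    \<comment> \<open>A maximal ideal contains \<open>E\<close> exactly when it lies outside
      \<open>W\<close>, and \<open>F\<close> exactly when it lies in \<open>W\<close>; none contains
      both.\<close>
    have "F \<subseteq> I W" "E \<subseteq> I (- W)" using E F unfolding I_def by blast+
    moreover have "\<not> F \<subseteq> P \<or> \<not> E \<subseteq> P" using E F P unfolding Max_spec_def by blast
    ultimately show "\<not> I W <+> I (- W) \<subseteq> P" using sub by blast
  qed
  then have "\<one> \<in> I W <+> I (- W)" by simp
  then obtain u e where ue: "u \<in> I W" "e \<in> I (- W)" "u \<oplus> e = \<one>"
    unfolding set_add_def' by auto
  have mem: "x \<in> P" if "x \<in> I V" "maximalideal P R" "P \<in> V" for x P V
    using that by (auto simp: I_def Max_spec_def)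
  show thesis
  proof (rule that)
    show "e \<in> carrier R" "u \<in> carrier R" using ideal.Icarr[OF I] ue(1,2) by auto
    show "u \<oplus> e = \<one>" by (rule ue(3))
    show "u \<in> P" if "maximalideal P R" "P \<in> W" for P
      using mem[OF ue(1)] that by simp
    show "e \<in> P" if "maximalideal P R" "P \<notin> W" for P
      using mem[OF ue(2)] that by simp
  qed
qed

section \<open>Comparability at a maximal ideal and local divisibility\<close>

text \<open>The principal ideals of the fractions \<open>a / 1\<close> and \<open>b / 1\<close> are
  comparable in the localization; clearing denominators brings the containment back to
  \<open>R\<close>.\<close>

lemma valuation_localization_comparable:
  assumes P: "maximalideal P R" and val: "valuation_ring (localization_at R P)"
    and ab: "a \<in> carrier R" "b \<in> carrier R"
  obtains s x where "s \<in> carrier R" "s \<notin> P" "x \<in> carrier R" "s \<otimes> a = x \<otimes> b"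
    | s x where "s \<in> carrier R" "s \<notin> P" "x \<in> carrier R" "s \<otimes> b = x \<otimes> a"
proof -
  let ?S = "carrier R - P"
  let ?L = "localization R ?S"
  interpret S: mult_closed_subset R ?S by (rule mult_closed_subset_maximalideal[OF is_cring P])
  interpret L: cring ?L by (rule S.cring_localization)
  have fraction: "\<exists>s x. s \<in> ?S \<and> x \<in> carrier R \<and> s \<otimes> y = x \<otimes> z"
    if sub: "PIdl\<^bsub>?L\<^esub> (frac_class R ?S y \<one>) \<subseteq> PIdl\<^bsub>?L\<^esub> (frac_class R ?S z \<one>)"
      and yz: "y \<in> carrier R" "z \<in> carrier R" for y z
  proof -
    have "frac_class R ?S y \<one> \<in> PIdl\<^bsub>?L\<^esub> (frac_class R ?S z \<one>)"
      using sub L.cgenideal_self S.frac_class_carrier[OF yz(1) S.S_one] by blast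
    then obtain w where w: "w \<in> carrier ?L"
      "frac_class R ?S y \<one> = w \<otimes>\<^bsub>?L\<^esub> frac_class R ?S z \<one>"
      by (auto simp: cgenideal_def)
    obtain x t where x: "w = frac_class R ?S x t" "x \<in> carrier R" "t \<in> ?S"
      by (rule S.localization_cases[OF w(1)])
    have "frac_class R ?S y \<one> = frac_class R ?S (x \<otimes> z) (t \<otimes> \<one>)"
      using w(2) x yz S.S_one by (simp add: S.localization_mult)
    then have "(x \<otimes> z, t \<otimes> \<one>) \<in> frac_class R ?S y \<one>"
      using S.frac_rel_refl[of "x \<otimes> z" "t \<otimes> \<one>"] x yz by simp
    \<comment> \<open>Fractions agree only up to a factor \<open>v\<close> outside \<open>P\<close>;
      together with the denominator \<open>t\<close> it gives the multiplier
      \<open>v \<otimes> t\<close>.\<close>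
    then obtain v where v: "v \<in> ?S" "v \<otimes> (y \<otimes> (t \<otimes> \<one>)) = v \<otimes> ((x \<otimes> z) \<otimes> \<one>)"
      unfolding S.frac_rel_iff[OF yz(1) S.S_one] by auto
    have "(v \<otimes> t) \<otimes> y = v \<otimes> (y \<otimes> (t \<otimes> \<one>))" using v(1) x yz by (simp add: m_ac)
    also have "\<dots> = (v \<otimes> x) \<otimes> z" unfolding v(2) using v(1) x yz by (simp add: m_assoc)
    finally have "(v \<otimes> t) \<otimes> y = (v \<otimes> x) \<otimes> z" .
    moreover have "v \<otimes> x \<in> carrier R" using v(1) x(2) by simp
    ultimately show ?thesis using S.S_mult[OF v(1) x(3)] by (intro exI conjI)
  qed
  have ideals: "ideal (PIdl\<^bsub>?L\<^esub> (frac_class R ?S y \<one>)) ?L" if "y \<in> carrier R" for y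
    by (rule L.cgenideal_ideal[OF S.frac_class_carrier[OF that S.S_one]])
  have "PIdl\<^bsub>?L\<^esub> (frac_class R ?S a \<one>) \<subseteq> PIdl\<^bsub>?L\<^esub> (frac_class R ?S b \<one>) \<or>
      PIdl\<^bsub>?L\<^esub> (frac_class R ?S b \<one>) \<subseteq> PIdl\<^bsub>?L\<^esub> (frac_class R ?S a \<one>)"
    using val ideals[OF ab(1)] ideals[OF ab(2)]
    unfolding valuation_ring_def localization_at_def by simp
  then show thesis
  proof
    assume "PIdl\<^bsub>?L\<^esub> (frac_class R ?S a \<one>) \<subseteq> PIdl\<^bsub>?L\<^esub> (frac_class R ?S b \<one>)"
    from fraction[OF this ab] show thesis using that(1) by blast
  next
    assume "PIdl\<^bsub>?L\<^esub> (frac_class R ?S b \<one>) \<subseteq> PIdl\<^bsub>?L\<^esub> (frac_class R ?S a \<one>)"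
    from fraction[OF this ab(2,1)] show thesis using that(2) by blast
  qed
qed

text \<open>The multipliers \<open>s\<close> for which \<open>d\<close> divides
  \<open>s \<otimes> y\<close> form a colon ideal. It lies in no maximal ideal, so it contains
  \<one>.\<close>

lemma divides_of_locally_divides:
  assumes dy: "d \<in> carrier R" "y \<in> carrier R"
    and loc: "\<And>P. maximalideal P R \<Longrightarrow> \<exists>s\<in>carrier R - P. d divides (s \<otimes> y)"
  shows "d divides y"
proof -
  let ?I = "{s \<in> carrier R. d divides (s \<otimes> y)}"
  have "ideal ?I R"
  proof (rule idealI)
    show "subgroup ?I (add_monoid R)"
    proof (rule add.subgroupI)
      have "\<zero> \<in> ?I" using dy by (auto simp: factor_def intro!: bexI[of _ \<zero>])
      then show "?I \<noteq> {}" by blast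
      show "\<ominus> s \<in> ?I" if s: "s \<in> ?I" for s
      proof -
        obtain c where "c \<in> carrier R" "s \<otimes> y = d \<otimes> c" using s by (auto simp: factor_def)
        then have "\<ominus> c \<in> carrier R" "\<ominus> s \<otimes> y = d \<otimes> \<ominus> c"
          using s dy by (simp_all add: l_minus r_minus)
        then show ?thesis using s by (auto simp: factor_def)
      qed
      show "s \<oplus> t \<in> ?I" if st: "s \<in> ?I" "t \<in> ?I" for s t
      proof -
        obtain c c' where "c \<in> carrier R" "s \<otimes> y = d \<otimes> c" "c' \<in> carrier R" "t \<otimes> y = d \<otimes> c'"
          using st by (auto simp: factor_def)
        then have "c \<oplus> c' \<in> carrier R" "(s \<oplus> t) \<otimes> y = d \<otimes> (c \<oplus> c')"
          using st dy by (simp_all add: l_distr r_distr)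
        then show ?thesis using st by (auto simp: factor_def)
      qed
    qed auto
    show "x \<otimes> s \<in> ?I" if s: "s \<in> ?I" "x \<in> carrier R" for s x
    proof -
      obtain c where "c \<in> carrier R" "s \<otimes> y = d \<otimes> c" using s by (auto simp: factor_def)
      then have "x \<otimes> c \<in> carrier R" "(x \<otimes> s) \<otimes> y = d \<otimes> (x \<otimes> c)"
        using s dy by (simp_all add: m_assoc m_lcomm)
      then show ?thesis using s by (auto simp: factor_def)
    qed
    then show "s \<otimes> x \<in> ?I" if "s \<in> ?I" "x \<in> carrier R" for s x
      using that m_comm[of s x] by simp
  qed (fact ring_axioms)
  then have "?I = carrier R"
  proof (rule ideal_eq_carrierI)
    show "\<not> ?I \<subseteq> P" if "maximalideal P R" for P using loc[OF that] by blast
  qed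
  then have "\<one> \<in> ?I" by simp
  then show ?thesis using dy by simp
qed

lemma eq_one_minus:
  assumes "x \<in> carrier R" "y \<in> carrier R" "x \<oplus> y = \<one>"
  shows "x = \<one> \<ominus> y"
proof -
  have "x \<oplus> \<zero> = (x \<oplus> y) \<ominus> y" using assms(1,2) by algebra
  then show ?thesis using assms by simp
qed

text \<open>Cofactors with respect to \<open>d\<close> are determined only up to the annihilator of
  \<open>d\<close>. This freedom makes the cofactor of \<open>a\<close> congruent to 1 modulo
  \<open>e\<close> and that of \<open>b\<close> congruent to 1 modulo \<open>u\<close>.\<close>

lemma unit_combination_cofactors:
  assumes ab: "a \<in> carrier R" "b \<in> carrier R"
    and ue: "u \<in> carrier R" "e \<in> carrier R" "u \<oplus> e = \<one>"
    and split: "\<And>P. maximalideal P R \<Longrightarrow> u \<in> P \<or> e \<in> P"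
    and div: "(e \<otimes> b \<oplus> u \<otimes> a) divides a" "(e \<otimes> b \<oplus> u \<otimes> a) divides b"
  shows "\<exists>d\<in>carrier R. \<exists>a'\<in>carrier R. \<exists>b'\<in>carrier R. \<exists>c\<in>carrier R.
    a = a' \<otimes> d \<and> b = b' \<otimes> d \<and> a' \<oplus> c \<otimes> b' \<in> Units R"
proof -
  define d where "d = e \<otimes> b \<oplus> u \<otimes> a"
  have d: "d \<in> carrier R" using ab ue by (simp add: d_def)
  obtain a1 where a1: "a1 \<in> carrier R" "a = a1 \<otimes> d"
    using div(1) d m_comm unfolding d_def[symmetric] by (auto simp: factor_def)
  obtain b1 where b1: "b1 \<in> carrier R" "b = b1 \<otimes> d"
    using div(2) d m_comm unfolding d_def[symmetric] by (auto simp: factor_def)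
  have u: "u = \<one> \<ominus> e" using ue by (rule eq_one_minus)
  \<comment> \<open>\<open>z\<close> is the defect of
    \<open>e \<otimes> b1 \<oplus> u \<otimes> a1\<close> from 1; it annihilates \<open>d\<close>
    because multiplication by that combination fixes \<open>d\<close>.\<close>
  define z where "z = \<one> \<ominus> e \<otimes> b1 \<ominus> u \<otimes> a1"
  have z: "z \<in> carrier R" using ue a1 b1 by (simp add: z_def)
  have "d = (e \<otimes> b1 \<oplus> u \<otimes> a1) \<otimes> d"
    using d_def a1 b1 ue d by (simp add: l_distr m_assoc)
  moreover have "z \<otimes> d = d \<ominus> (e \<otimes> b1 \<oplus> u \<otimes> a1) \<otimes> d"
    unfolding z_def using a1(1) b1(1) ue(1,2) d by algebra
  ultimately have zd: "z \<otimes> d = \<zero>" using d by (simp add: r_right_minus_eq)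
  define a' where "a' = a1 \<oplus> u \<otimes> z"
  define b' where "b' = b1 \<oplus> e \<otimes> z"
  \<comment> \<open>With this \<open>c\<close>, one minus \<open>a' \<oplus> c \<otimes> b'\<close>
    factors as \<open>(\<one> \<ominus> a') \<otimes> (\<one> \<ominus> e \<otimes> b')\<close>, a
    multiple of \<open>e\<close> by the first factor and of \<open>u\<close> by the second.\<close>
  define c where "c = e \<otimes> (\<one> \<ominus> a')"
  have carr: "a' \<in> carrier R" "b' \<in> carrier R" "c \<in> carrier R"
    using a1 b1 ue z by (simp_all add: a'_def b'_def c_def)
  have "a = a' \<otimes> d" "b = b' \<otimes> d"
    using a1 b1 ue z d zd by (simp_all add: a'_def b'_def l_distr m_assoc)
  moreover have "a' \<oplus> c \<otimes> b' \<in> Units R"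
  proof (rule UnitsI_maximalideal)
    fix P assume P: "maximalideal P R"
    interpret P: maximalideal P R by fact
    let ?y = "a' \<oplus> c \<otimes> b'"
    \<comment> \<open>\<open>a'\<close> is congruent to 1 modulo \<open>e\<close>, and \<open>b'\<close> is congruent to 1 modulo \<open>u\<close>.\<close>
    have y1: "\<one> \<ominus> ?y = (\<one> \<ominus> a') \<otimes> (a1 \<oplus> z \<oplus> z \<ominus> u \<otimes> z) \<otimes> u"
    proof -
      have "\<one> \<ominus> e \<otimes> b' = (a1 \<oplus> z \<oplus> z \<ominus> u \<otimes> z) \<otimes> u"
        unfolding b'_def z_def u using a1(1) b1(1) ue(2) by algebra
      moreover have "\<one> \<ominus> ?y = (\<one> \<ominus> a') \<otimes> (\<one> \<ominus> e \<otimes> b')"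
        unfolding c_def using carr ue(2) by algebra
      ultimately show ?thesis using carr a1 ue z by (simp add: m_assoc)
    qed
    have y2: "\<one> \<ominus> ?y = (b1 \<ominus> a1 \<oplus> z \<ominus> (\<one> \<ominus> a') \<otimes> b') \<otimes> e"
    proof -
      have "\<one> \<ominus> a' = (b1 \<ominus> a1 \<oplus> z) \<otimes> e"
        unfolding a'_def z_def u using a1(1) b1(1) ue(2) by algebra
      moreover have "\<one> \<ominus> ?y = (\<one> \<ominus> a') \<ominus> (\<one> \<ominus> a') \<otimes> b' \<otimes> e"
        unfolding c_def using carr ue(2) by algebra
      moreover have "(b1 \<ominus> a1 \<oplus> z) \<otimes> e \<ominus> (\<one> \<ominus> a') \<otimes> b' \<otimes> e =
          (b1 \<ominus> a1 \<oplus> z \<ominus> (\<one> \<ominus> a') \<otimes> b') \<otimes> e"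
        using carr a1(1) b1(1) z ue(2) by algebra
      ultimately show ?thesis by simp
    qed
    have "\<one> \<ominus> ?y \<in> P"
      using split[OF P]
    proof
      assume "u \<in> P"
      then show ?thesis unfolding y1 using carr a1(1) ue(1) z by (intro P.I_l_closed) auto
    next
      assume "e \<in> P"
      then show ?thesis unfolding y2 using carr a1(1) b1(1) z by (intro P.I_l_closed) auto
    qed
    moreover have "\<one> \<ominus> (\<one> \<ominus> ?y) = ?y" using carr by algebra
    ultimately show "?y \<notin> P"
      using in_maximalideal_imp_one_minus_notin[OF P] by metis
  qed (use carr in simp)
  ultimately show ?thesis using d carr by blast
qed


text \<open>Locally at \<open>P\<close>, substituting \<open>a = (x / s) b\<close> gives
  \<open>d = (e + u x / s) b\<close>. The bracket is \<open>t / s\<close>, a unit because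
  \<open>e\<close> is congruent to 1 and \<open>u\<close> to 0. So \<open>b\<close>, and with it
  \<open>a\<close>, is locally a multiple of \<open>d\<close>.\<close>

lemma locally_divides_of_comparable:
  assumes P: "maximalideal P R"
    and carr: "a \<in> carrier R" "b \<in> carrier R" "u \<in> carrier R" "e \<in> carrier R"
      "s \<in> carrier R" "x \<in> carrier R"
    and ue: "u \<oplus> e = \<one>" "u \<in> P"
    and sx: "s \<notin> P" "s \<otimes> a = x \<otimes> b"
  shows "\<exists>t\<in>carrier R - P. (e \<otimes> b \<oplus> u \<otimes> a) divides (t \<otimes> a)"
    and "\<exists>t\<in>carrier R - P. (e \<otimes> b \<oplus> u \<otimes> a) divides (t \<otimes> b)"
proof -
  interpret P: maximalideal P R by fact
  interpret P: primeideal P R by (rule maximalideal_prime[OF P])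
  define d where "d = e \<otimes> b \<oplus> u \<otimes> a"
  define t where "t = s \<otimes> e \<oplus> u \<otimes> x"
  have t: "t \<in> carrier R" and d: "d \<in> carrier R" using carr by (simp_all add: t_def d_def)
  have "e = \<one> \<ominus> u" using carr(4,3) ue(1) by (intro eq_one_minus) (simp_all add: a_comm)
  moreover have "s \<oplus> \<zero> = s \<otimes> (\<one> \<ominus> u) \<oplus> u \<otimes> x \<oplus> (s \<ominus> x) \<otimes> u" using carr by algebra
  ultimately have "s \<oplus> \<zero> = t \<oplus> (s \<ominus> x) \<otimes> u" by (simp add: t_def)
  then have "s = t \<oplus> (s \<ominus> x) \<otimes> u" using carr(5) by simp
  moreover have "(s \<ominus> x) \<otimes> u \<in> P" using ue(2) carr by (intro P.I_l_closed) auto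
  ultimately have t_notin: "t \<notin> P" using sx(1) P.a_closed by metis
  have "t \<otimes> b = s \<otimes> e \<otimes> b \<oplus> u \<otimes> (x \<otimes> b)" unfolding t_def using carr by algebra
  also have "\<dots> = d \<otimes> s" unfolding sx(2)[symmetric] d_def using carr by algebra
  finally have tb: "t \<otimes> b = d \<otimes> s" .
  have "(s \<otimes> t) \<otimes> a = t \<otimes> (s \<otimes> a)" using carr t by (simp add: m_ac)
  also have "\<dots> = x \<otimes> (t \<otimes> b)" unfolding sx(2) using carr t by (simp add: m_ac)
  also have "\<dots> = d \<otimes> (x \<otimes> s)" unfolding tb using carr d by (simp add: m_ac)
  finally have ta: "(s \<otimes> t) \<otimes> a = d \<otimes> (x \<otimes> s)" .
  have "s \<otimes> t \<notin> P" using P.I_prime carr t sx(1) t_notin by blast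
  then show "\<exists>t\<in>carrier R - P. (e \<otimes> b \<oplus> u \<otimes> a) divides (t \<otimes> a)"
    unfolding d_def[symmetric] using ta carr t
    by (intro bexI[of _ "s \<otimes> t"]) (auto intro: dividesI)
  show "\<exists>t\<in>carrier R - P. (e \<otimes> b \<oplus> u \<otimes> a) divides (t \<otimes> b)"
    unfolding d_def[symmetric] using tb carr t t_notin
    by (intro bexI[of _ t]) (auto intro: dividesI)
qed

section \<open>Clopen separation and the unit property\<close>

text \<open>The maximal ideals at which \<open>a\<close> is not locally a multiple of
  \<open>b\<close>, and those with the roles exchanged, form disjoint closed sets; \<open>W\<close>
  separates them.\<close>

lemma arithmetic_clopen_cover:
  assumes arith: "arithmetic_ring R"
    and top: "Hausdorff_space (Max_topology R)" "totally_disconnected_space (Max_topology R)"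
    and ab: "a \<in> carrier R" "b \<in> carrier R"
  obtains W where "openin (Max_topology R) W" "closedin (Max_topology R) W"
    "\<And>P. maximalideal P R \<Longrightarrow> P \<in> W \<Longrightarrow>
      \<exists>s\<in>carrier R - P. \<exists>x\<in>carrier R. s \<otimes> a = x \<otimes> b"
    "\<And>P. maximalideal P R \<Longrightarrow> P \<notin> W \<Longrightarrow>
      \<exists>s\<in>carrier R - P. \<exists>x\<in>carrier R. s \<otimes> b = x \<otimes> a"
proof -
  let ?X = "Max_topology R"
  \<comment> \<open>\<open>?C a b\<close> is the colon ideal of multipliers taking \<open>a\<close>
    into the multiples of \<open>b\<close>; \<open>?V a b\<close> collects the maximal ideals that
    leave no such multiplier outside.\<close>
  let ?C = "\<lambda>a b. {s \<in> carrier R. \<exists>x\<in>carrier R. s \<otimes> a = x \<otimes> b}"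
  let ?V = "\<lambda>a b. {P \<in> Max_spec R. ?C a b \<subseteq> P}"
  have closed: "closedin ?X (?V y z)" for y z
  proof -
    have "openin ?X (Max_spec R - ?V y z)"
      unfolding openin_Max_topology[OF is_cring] Zariski_open_def
      by (rule exI[of _ "?C y z"]) simp
    then show ?thesis
      unfolding closedin_def topspace_Max_topology[OF is_cring] by simp
  qed
  have disj: "?V b a \<inter> ?V a b = {}"
  proof (rule ccontr)
    assume "?V b a \<inter> ?V a b \<noteq> {}"
    then obtain P where P: "maximalideal P R" "?C b a \<subseteq> P" "?C a b \<subseteq> P"
      by (auto simp: Max_spec_def)
    have "valuation_ring (localization_at R P)"
      using arith P(1) by (simp add: arithmetic_ring_def)
    from valuation_localization_comparable[OF P(1) this ab] show False
      using P(2,3) by cases auto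
  qed
  \<comment> \<open>In a compact Hausdorff space, closed sets that no connected set meets
    simultaneously are separated by a clopen set. Here a connected set has at most one
    point.\<close>
  have "separated_between ?X (?V b a) (?V a b)"
  proof (rule cut_wire_fence_theorem[OF compact_space_Max_topology top(1) closed closed])
    show "disjnt C (?V b a) \<or> disjnt C (?V a b)" if "connectedin ?X C" for C
    proof (rule ccontr)
      assume "\<not> ?thesis"
      then obtain P Q where PQ: "P \<in> C" "P \<in> ?V b a" "Q \<in> C" "Q \<in> ?V a b"
        unfolding disjnt_iff by auto
      then have "P = Q" using top(2) that unfolding totally_disconnected_space_def by auto
      then show False using PQ disj by auto
    qed
  qed
  then obtain W where W: "closedin ?X W" "openin ?X W" "?V b a \<subseteq> W"
    "?V a b \<subseteq> topspace ?X - W"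
    unfolding separated_between by auto
  show thesis
  proof (rule that[OF W(2,1)])
    fix P assume P: "maximalideal P R"
    show "\<exists>s\<in>carrier R - P. \<exists>x\<in>carrier R. s \<otimes> a = x \<otimes> b" if "P \<in> W"
    proof -
      have "P \<notin> ?V a b" using W(4) that by blast
      then show ?thesis using P by (auto simp: Max_spec_def)
    qed
    show "\<exists>s\<in>carrier R - P. \<exists>x\<in>carrier R. s \<otimes> b = x \<otimes> a" if "P \<notin> W"
    proof -
      have "P \<notin> ?V b a" using W(3) that by blast
      then show ?thesis using P by (auto simp: Max_spec_def)
    qed
  qed
qed

lemma arithmetic_unit_combination:
  assumes arith: "arithmetic_ring R"
    and top: "Hausdorff_space (Max_topology R)" "totally_disconnected_space (Max_topology R)"
    and ab: "a \<in> carrier R" "b \<in> carrier R"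
  shows "\<exists>d\<in>carrier R. \<exists>a'\<in>carrier R. \<exists>b'\<in>carrier R. \<exists>c\<in>carrier R.
    a = a' \<otimes> d \<and> b = b' \<otimes> d \<and> a' \<oplus> c \<otimes> b' \<in> Units R"
proof -
  obtain W where W: "openin (Max_topology R) W" "closedin (Max_topology R) W"
    and in_W: "\<And>P. maximalideal P R \<Longrightarrow> P \<in> W \<Longrightarrow>
      \<exists>s\<in>carrier R - P. \<exists>x\<in>carrier R. s \<otimes> a = x \<otimes> b"
    and notin_W: "\<And>P. maximalideal P R \<Longrightarrow> P \<notin> W \<Longrightarrow>
      \<exists>s\<in>carrier R - P. \<exists>x\<in>carrier R. s \<otimes> b = x \<otimes> a"
    by (rule arithmetic_clopen_cover[OF arith top ab]) blast
  obtain e u where eu: "e \<in> carrier R" "u \<in> carrier R" "u \<oplus> e = \<one>"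
    and u_in: "\<And>P. maximalideal P R \<Longrightarrow> P \<in> W \<Longrightarrow> u \<in> P"
    and e_in: "\<And>P. maximalideal P R \<Longrightarrow> P \<notin> W \<Longrightarrow> e \<in> P"
    by (rule clopen_imp_comaximal_split[OF W]) blast
  \<comment> \<open>On \<open>W\<close>, \<open>a\<close> is locally a multiple of \<open>b\<close>
    and \<open>e\<close> is a local unit; off \<open>W\<close> the roles are exchanged. In both
    cases \<open>?d\<close> is locally a generator of the ideal of \<open>a\<close> and
    \<open>b\<close>.\<close>
  let ?d = "e \<otimes> b \<oplus> u \<otimes> a"
  have d: "?d \<in> carrier R" using ab eu by simp
  have eu': "e \<oplus> u = \<one>" using eu by (simp add: a_comm)
  have d': "?d = u \<otimes> a \<oplus> e \<otimes> b" using ab eu by (simp add: a_comm)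
  have loc: "(\<exists>t\<in>carrier R - P. ?d divides (t \<otimes> a)) \<and> (\<exists>t\<in>carrier R - P. ?d divides (t \<otimes> b))"
    if P: "maximalideal P R" for P
  proof (cases "P \<in> W")
    case True
    from in_W[OF P True] obtain s x where sx: "s \<in> carrier R" "s \<notin> P" "x \<in> carrier R"
      "s \<otimes> a = x \<otimes> b" by auto
    show ?thesis
      using locally_divides_of_comparable[OF P ab eu(2,1) sx(1,3) eu(3) u_in[OF P True] sx(2,4)]
      by (rule conjI)
  next
    case False
    from notin_W[OF P False] obtain s x where sx: "s \<in> carrier R" "s \<notin> P" "x \<in> carrier R"
      "s \<otimes> b = x \<otimes> a" by auto
    show ?thesis
      unfolding d'
      using locally_divides_of_comparable(2,1)[OF P ab(2,1) eu(1,2) sx(1,3) eu' e_in[OF P False]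
          sx(2,4)]
      by (rule conjI)
  qed
  show ?thesis
  proof (rule unit_combination_cofactors[OF ab eu(2,1,3)])
    show "u \<in> P \<or> e \<in> P" if "maximalideal P R" for P using u_in e_in that by auto
    show "?d divides a" "?d divides b"
      using divides_of_locally_divides[OF d] ab loc by auto
  qed
qed

end

section \<open>Diagonal reduction of matrices\<close>

context cring
begin

definition add_row :: "nat \<Rightarrow> nat \<Rightarrow> 'a \<Rightarrow> (nat \<Rightarrow> nat \<Rightarrow> 'a) \<Rightarrow> nat \<Rightarrow> nat \<Rightarrow> 'a" where
  "add_row i k s A = (\<lambda>p q. if p = i then A i q \<oplus> s \<otimes> A k q else A p q)"

definition add_col :: "nat \<Rightarrow> nat \<Rightarrow> 'a \<Rightarrow> (nat \<Rightarrow> nat \<Rightarrow> 'a) \<Rightarrow> nat \<Rightarrow> nat \<Rightarrow> 'a" where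
  "add_col i k s A = (\<lambda>p q. if q = i then A p i \<oplus> s \<otimes> A p k else A p q)"

text \<open>Entries lie in the ring at all indices, so that computations with operations carry no
  range conditions.\<close>

definition carrier_mat :: "(nat \<Rightarrow> nat \<Rightarrow> 'a) \<Rightarrow> bool" where
  "carrier_mat A \<longleftrightarrow> (\<forall>i j. A i j \<in> carrier R)"

text \<open>An \<open>m \<times> n\<close> matrix is a function whose values outside the index range are irrelevant. The bound
  \<open>l\<close> restricts the operations to the lower right block, for recursion on the pivot position.\<close>

inductive elem_equiv ::
    "nat \<Rightarrow> nat \<Rightarrow> nat \<Rightarrow> (nat \<Rightarrow> nat \<Rightarrow> 'a) \<Rightarrow> (nat \<Rightarrow> nat \<Rightarrow> 'a) \<Rightarrow> bool"
  for l m n A where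
  refl: "elem_equiv l m n A A"
| row: "elem_equiv l m n A B \<Longrightarrow> i \<in> {l..<m} \<Longrightarrow> k \<in> {l..<m} \<Longrightarrow> i \<noteq> k \<Longrightarrow> s \<in> carrier R \<Longrightarrow>
    elem_equiv l m n A (add_row i k s B)"
| col: "elem_equiv l m n A B \<Longrightarrow> i \<in> {l..<n} \<Longrightarrow> k \<in> {l..<n} \<Longrightarrow> i \<noteq> k \<Longrightarrow> s \<in> carrier R \<Longrightarrow>
    elem_equiv l m n A (add_col i k s B)"

lemma carrier_matD: "carrier_mat A \<Longrightarrow> A i j \<in> carrier R"
  by (simp add: carrier_mat_def)

lemma carrier_mat_add_row: "carrier_mat A \<Longrightarrow> s \<in> carrier R \<Longrightarrow> carrier_mat (add_row i k s A)"
  by (simp add: carrier_mat_def add_row_def)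

lemma carrier_mat_add_col: "carrier_mat A \<Longrightarrow> s \<in> carrier R \<Longrightarrow> carrier_mat (add_col i k s A)"
  by (simp add: carrier_mat_def add_col_def)

lemma elem_equiv_carrier_mat: "elem_equiv l m n A B \<Longrightarrow> carrier_mat A \<Longrightarrow> carrier_mat B"
  by (induction rule: elem_equiv.induct) (simp_all add: carrier_mat_add_row carrier_mat_add_col)

lemma elem_equiv_trans:
  assumes "elem_equiv l m n A B" "elem_equiv l m n B C"
  shows "elem_equiv l m n A C"
  using assms(2,1) by (induction rule: elem_equiv.induct) (auto intro: elem_equiv.intros)

lemma elem_equiv_mono: "elem_equiv l m n A B \<Longrightarrow> l' \<le> l \<Longrightarrow> elem_equiv l' m n A B"
  by (induction rule: elem_equiv.induct) (auto intro: elem_equiv.intros)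

text \<open>Through this symmetry the statements on rows follow from those on columns.\<close>

lemma elem_equiv_transpose:
  "elem_equiv l m n A B \<Longrightarrow> elem_equiv l n m (\<lambda>i j. A j i) (\<lambda>i j. B j i)"
proof (induction rule: elem_equiv.induct)
  case refl
  show ?case by (rule elem_equiv.refl)
next
  case (row B i k s)
  have "(\<lambda>p q. add_row i k s B q p) = add_col i k s (\<lambda>p q. B q p)"
    by (simp add: add_row_def add_col_def)
  then show ?case using elem_equiv.col[OF row.IH row.hyps(2-5)] by simp
next
  case (col B i k s)
  have "(\<lambda>p q. add_col i k s B q p) = add_row i k s (\<lambda>p q. B q p)"
    by (simp add: add_row_def add_col_def)
  then show ?case using elem_equiv.row[OF col.IH col.hyps(2-5)] by simp
qed

lemma divides_combination:
  assumes "d divides x" "d divides y" "d \<in> carrier R" "s \<in> carrier R"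
  shows "d divides (x \<oplus> s \<otimes> y)"
proof -
  obtain v w where "v \<in> carrier R" "x = d \<otimes> v" "w \<in> carrier R" "y = d \<otimes> w"
    using assms(1,2) by (auto elim!: dividesE)
  then have "x \<oplus> s \<otimes> y = d \<otimes> (v \<oplus> s \<otimes> w)" "v \<oplus> s \<otimes> w \<in> carrier R"
    using assms(3,4) by (simp_all add: r_distr m_lcomm)
  then show ?thesis by (auto intro: dividesI)
qed

text \<open>Each operation replaces entries of the block by combinations of entries of the block,
  and a common divisor divides combinations.\<close>

lemma elem_equiv_divides:
  assumes "elem_equiv l m n A B" "d \<in> carrier R"
    and "\<And>i j. i \<in> {l..<m} \<Longrightarrow> j \<in> {l..<n} \<Longrightarrow> d divides (A i j)"
    and "i \<in> {l..<m}" "j \<in> {l..<n}"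
  shows "d divides (B i j)"
  using assms
  by (induction arbitrary: i j rule: elem_equiv.induct)
    (simp_all add: add_row_def add_col_def divides_combination)

text \<open>Column operations on the smaller block leave column \<open>l\<close> alone, and row
  operations there only combine its zero entries.\<close>

lemma elem_equiv_Suc_column_zero:
  assumes "elem_equiv (Suc l) m n A B" "carrier_mat A"
    and "\<And>i. i \<in> {l<..<m} \<Longrightarrow> A i l = \<zero>" and "i \<in> {l<..<m}"
  shows "B i l = \<zero>"
  using assms
  by (induction arbitrary: i rule: elem_equiv.induct) (auto simp: add_row_def add_col_def)

lemma elem_equiv_Suc_row_zero:
  assumes "elem_equiv (Suc l) m n A B" "carrier_mat A"
    and "\<And>j. j \<in> {l<..<n} \<Longrightarrow> A l j = \<zero>" and "j \<in> {l<..<n}"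
  shows "B l j = \<zero>"
  using elem_equiv_Suc_column_zero[OF elem_equiv_transpose[OF assms(1)] _ assms(3,4)] assms(2)
  by (simp add: carrier_mat_def)

lemma clear_column:
  assumes A: "carrier_mat A" and l: "l < m"
    and div: "\<And>i. i \<in> {l<..<m} \<Longrightarrow> (A l l) divides (A i l)"
  obtains B where "elem_equiv l m n A B" "\<And>q. B l q = A l q"
    "\<And>i. i \<in> {l<..<m} \<Longrightarrow> B i l = \<zero>"
proof -
  \<comment> \<open>Induction on the first row \<open>r\<close> not yet treated: row
    \<open>l\<close> never changes and later rows keep their entry in column \<open>l\<close>, so
    \<open>div\<close> still applies to row \<open>r\<close>.\<close>
  have "\<exists>B. elem_equiv l m n A B \<and> (\<forall>q. B l q = A l q) \<and> (\<forall>i\<in>{l<..<r}. B i l = \<zero>) \<and>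
      (\<forall>i\<in>{r..<m}. B i l = A i l)" if "Suc l \<le> r" "r \<le> m" for r
    using that
  proof (induction r rule: dec_induct)
    case base
    show ?case by (intro exI[of _ A]) (auto intro: elem_equiv.refl)
  next
    case (step r)
    then obtain B where B: "elem_equiv l m n A B" "\<forall>q. B l q = A l q" "\<forall>i\<in>{l<..<r}. B i l = \<zero>"
      "\<forall>i\<in>{r..<m}. B i l = A i l" by auto
    have r: "l < r" "r < m" using step by auto
    then obtain t where t: "t \<in> carrier R" "A r l = A l l \<otimes> t"
      using div[of r] by (auto elim: dividesE)
    have "elem_equiv l m n A (add_row r l (\<ominus> t) B)"
      using elem_equiv.row[OF B(1), of r l "\<ominus> t"] r t(1) by simp
    moreover have "add_row r l (\<ominus> t) B r l = \<zero>"
    proof -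
      have "A l l \<otimes> t \<oplus> \<ominus> t \<otimes> A l l = \<zero>"
        using t(1) carrier_matD[OF A, of l l] by algebra
      then show ?thesis using B(2,4) r t(2) by (simp add: add_row_def)
    qed
    ultimately show ?case
      using B r by (intro exI[of _ "add_row r l (\<ominus> t) B"]) (auto simp: add_row_def less_Suc_eq)
  qed
  from this[of m] show thesis using l that by auto
qed

lemma clear_row:
  assumes A: "carrier_mat A" and l: "l < n"
    and div: "\<And>j. j \<in> {l<..<n} \<Longrightarrow> (A l l) divides (A l j)"
  obtains B where "elem_equiv l m n A B" "\<And>p. B p l = A p l"
    "\<And>j. j \<in> {l<..<n} \<Longrightarrow> B l j = \<zero>"
proof -
  obtain B where B: "elem_equiv l n m (\<lambda>i j. A j i) B" "\<And>q. B l q = A q l"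
    "\<And>i. i \<in> {l<..<n} \<Longrightarrow> B i l = \<zero>"
    using clear_column[of "\<lambda>i j. A j i" l n m] A l div by (auto simp: carrier_mat_def)
  show thesis
    using that[of "\<lambda>i j. B j i"] elem_equiv_transpose[OF B(1)] B(2,3) by simp
qed

end

section \<open>Diagonal reduction from a gcd condition\<close>

text \<open>The element \<open>a \<oplus> c \<otimes> b\<close> then divides \<open>a\<close> too,
  so it generates the ideal of \<open>a\<close> and \<open>b\<close>: a single row addition turns a
  pivot into a gcd.\<close>

locale gcd_combination_ring = cring +
  assumes gcd_combination:
    "a \<in> carrier R \<Longrightarrow> b \<in> carrier R \<Longrightarrow> \<exists>c\<in>carrier R. (a \<oplus> c \<otimes> b) divides b"
begin

text \<open>The rows below are added to row \<open>l\<close> one after another, with coefficients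
  from \<open>gcd_combination\<close>. They stay unchanged themselves, so each entry met is the
  original one.\<close>

lemma column_gcd:
  assumes A: "carrier_mat A" and l: "l < m"
  obtains B where "elem_equiv l m n A B" "\<And>i q. i \<noteq> l \<Longrightarrow> B i q = A i q"
    "\<And>i. i \<in> {l..<m} \<Longrightarrow> (B l l) divides (A i l)"
proof -
  have "\<exists>B. elem_equiv l m n A B \<and> (\<forall>i q. i \<noteq> l \<longrightarrow> B i q = A i q) \<and>
      (\<forall>i\<in>{l..<r}. (B l l) divides (A i l))" if "Suc l \<le> r" "r \<le> m" for r
    using that
  proof (induction r rule: dec_induct)
    case base
    show ?case
      by (intro exI[of _ A]) (auto intro: elem_equiv.refl divides_refl carrier_matD[OF A])
  next
    case (step r)
    then obtain B where B: "elem_equiv l m n A B" "\<forall>i q. i \<noteq> l \<longrightarrow> B i q = A i q"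
      "\<forall>i\<in>{l..<r}. (B l l) divides (A i l)" by auto
    have r: "l < r" "r < m" using step by auto
    have carr: "B l l \<in> carrier R" "A r l \<in> carrier R"
      using elem_equiv_carrier_mat[OF B(1) A] A by (simp_all add: carrier_mat_def)
    then obtain c where c: "c \<in> carrier R" "(B l l \<oplus> c \<otimes> A r l) divides (A r l)"
      using gcd_combination[OF carr] by (elim bexE)
    let ?g = "B l l \<oplus> c \<otimes> A r l"
    \<comment> \<open>The old pivot is a combination of \<open>?g\<close> and \<open>A r l\<close>,
      so \<open>?g\<close> divides it and everything that it divides.\<close>
    have "?g divides (?g \<oplus> \<ominus> c \<otimes> A r l)"
      using carr c by (intro divides_combination divides_refl) auto
    moreover have "?g \<oplus> \<ominus> c \<otimes> A r l = B l l"
      using carr c(1) by (simp add: a_assoc l_minus r_neg)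
    ultimately have "?g divides (A i l)" if "i \<in> {l..<r}" for i
      using B(3) that carr c carrier_matD[OF A] divides_trans[of ?g "B l l" "A i l"] by auto
    moreover have "add_row l r c B l l = ?g" using B(2) r by (simp add: add_row_def)
    ultimately have "\<forall>i\<in>{l..<Suc r}. (add_row l r c B l l) divides (A i l)"
      using c(2) by (auto simp: less_Suc_eq)
    moreover have "elem_equiv l m n A (add_row l r c B)"
      using elem_equiv.row[OF B(1), of l r c] r c(1) by simp
    ultimately show ?case
      using B(2) by (intro exI[of _ "add_row l r c B"]) (auto simp: add_row_def)
  qed
  from this[of m] show thesis using l that by auto
qed

lemma row_gcd:
  assumes A: "carrier_mat A" and l: "l < n"
  obtains B where "elem_equiv l m n A B" "\<And>j. j \<in> {l..<n} \<Longrightarrow> (B l l) divides (A l j)"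
proof -
  obtain B where B: "elem_equiv l n m (\<lambda>i j. A j i) B"
    "\<And>i. i \<in> {l..<n} \<Longrightarrow> (B l l) divides (A l i)"
    by (rule column_gcd[of "\<lambda>i j. A j i" l n m]) (use A l in \<open>auto simp: carrier_mat_def\<close>)
  show thesis
    using that[of "\<lambda>i j. B j i"] elem_equiv_transpose[OF B(1)] B(2) by simp
qed

text \<open>Since column \<open>j\<close> of the lower block has only the entry \<open>A j j\<close>, adding a multiple of row \<open>j\<close> to row
  \<open>l\<close> makes \<open>A l j\<close> divide it without disturbing the other columns.\<close>

lemma row_divides_diagonal_block:
  assumes A: "carrier_mat A" and l: "l < m"
    and diag: "\<And>i j. i \<in> {l<..<m} \<Longrightarrow> j \<in> {l<..<n} \<Longrightarrow> i \<noteq> j \<Longrightarrow> A i j = \<zero>"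
  obtains B where "elem_equiv l m n A B" "\<And>i q. i \<noteq> l \<Longrightarrow> B i q = A i q"
    "\<And>i j. i \<in> {l<..<m} \<Longrightarrow> j \<in> {l<..<n} \<Longrightarrow> (B l j) divides (A i j)"
proof -
  have "\<exists>B. elem_equiv l m n A B \<and> (\<forall>i q. i \<noteq> l \<longrightarrow> B i q = A i q) \<and>
      (\<forall>i\<in>{l<..<r}. \<forall>j\<in>{l<..<n}. (B l j) divides (A i j))" if "Suc l \<le> r" "r \<le> m" for r
    using that
  proof (induction r rule: dec_induct)
    case base
    show ?case by (intro exI[of _ A]) (auto intro: elem_equiv.refl)
  next
    case (step r)
    then obtain B where B: "elem_equiv l m n A B" "\<forall>i q. i \<noteq> l \<longrightarrow> B i q = A i q"
      "\<forall>i\<in>{l<..<r}. \<forall>j\<in>{l<..<n}. (B l j) divides (A i j)" by auto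
    have r: "l < r" "r < m" using step by auto
    have carr: "B i j \<in> carrier R" "A i j \<in> carrier R" for i j
      using elem_equiv_carrier_mat[OF B(1) A] A by (simp_all add: carrier_mat_def)
    have zero: "x divides \<zero>" if "x \<in> carrier R" for x
      using that by (intro dividesI[of \<zero>]) simp_all
    \<comment> \<open>If \<open>r \<ge> n\<close>, then \<open>A r r\<close> lies outside the matrix
      but still in the ring; row \<open>r\<close> then vanishes on all columns between
      \<open>l\<close> and \<open>n\<close>, so any \<open>c\<close> serves.\<close>
    obtain c where c: "c \<in> carrier R" "(B l r \<oplus> c \<otimes> A r r) divides (A r r)"
      using gcd_combination[OF carr(1)[of l r] carr(2)[of r r]] by (elim bexE)
    let ?B = "add_row l r c B"
    \<comment> \<open>Row \<open>r\<close> vanishes at these columns, so the divisibility gained for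
      earlier rows is kept.\<close>
    have Blj: "?B l j = B l j" if "j \<in> {l<..<n}" "j \<noteq> r" for j
      using B(2) that r diag[of r j] carr c(1) by (simp add: add_row_def)
    have Blr: "?B l r = B l r \<oplus> c \<otimes> A r r" using B(2) r by (simp add: add_row_def)
    have "(?B l j) divides (A i j)" if i: "i \<in> {l<..<Suc r}" and j: "j \<in> {l<..<n}" for i j
    proof (cases "i = j")
      case True
      then show ?thesis
        using c(2) Blr Blj[OF j] B(3) i j by (cases "i = r") auto
    next
      case False
      then have "A i j = \<zero>" using diag[of i j] i j r by auto
      then show ?thesis using zero carrier_matD[OF carrier_mat_add_row] carr c(1)
        by (simp add: carrier_mat_def)
    qed
    moreover have "elem_equiv l m n A ?B"
      using elem_equiv.row[OF B(1), of l r c] r c(1) by simp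
    ultimately show ?case
      using B(2) by (intro exI[of _ ?B]) (auto simp: add_row_def)
  qed
  from this[of m] show thesis using l that by auto
qed

text \<open>The induction hypothesis is used twice: once to diagonalize the lower block so that the pivot can
  be made a divisor of all entries, and again after the pivot has cleared its row and column.\<close>

theorem diagonal_reduction:
  assumes "carrier_mat A"
  shows "\<exists>B. elem_equiv l m n A B \<and> (\<forall>i\<in>{l..<m}. \<forall>j\<in>{l..<n}. i \<noteq> j \<longrightarrow> B i j = \<zero>)"
  using assms
\<comment> \<open>The number of remaining rows decreases; the matrix keeps its size and only the
  pivot position moves.\<close>
proof (induction "m - l" arbitrary: l A)
  case 0
  then show ?case by (intro exI[of _ A]) (simp add: elem_equiv.refl)
next
  case (Suc k)
  show ?case
  proof (cases "l < n")
    case False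
    then show ?thesis by (intro exI[of _ A]) (simp add: elem_equiv.refl)
  next
    case n: True
    have m: "l < m" and k: "k = m - Suc l" using Suc.hyps(2) by auto
    note carrier = elem_equiv_carrier_mat
    \<comment> \<open>First pass: a pivot that divides its column lets the column be cleared, after
      which the lower block is diagonalized.\<close>
    obtain B1 where B1: "elem_equiv l m n A B1" "\<And>i q. i \<noteq> l \<Longrightarrow> B1 i q = A i q"
      "\<And>i. i \<in> {l..<m} \<Longrightarrow> (B1 l l) divides (A i l)"
      using column_gcd[OF Suc.prems m] by metis
    note c1 = carrier[OF B1(1) Suc.prems]
    obtain B2 where B2: "elem_equiv l m n B1 B2" "\<And>i. i \<in> {l<..<m} \<Longrightarrow> B2 i l = \<zero>"
      by (rule clear_column[OF c1 m, of n]) (use B1 in auto)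
    note c2 = carrier[OF B2(1) c1]
    obtain B3 where B3: "elem_equiv (Suc l) m n B2 B3"
      "\<forall>i\<in>{Suc l..<m}. \<forall>j\<in>{Suc l..<n}. i \<noteq> j \<longrightarrow> B3 i j = \<zero>"
      using Suc.hyps(1)[OF k c2] by auto
    note c3 = carrier[OF B3(1) c2]
    have B3l: "B3 i l = \<zero>" if "i \<in> {l<..<m}" for i
      using elem_equiv_Suc_column_zero[OF B3(1) c2 B2(2) that] .
    \<comment> \<open>Column \<open>l\<close> is zero below the pivot, and each entry of the lower
      block becomes a multiple of the entry of row \<open>l\<close> above it. A pivot that divides
      row \<open>l\<close> therefore divides the whole block.\<close>
    obtain B4 where B4: "elem_equiv l m n B3 B4" "\<And>i q. i \<noteq> l \<Longrightarrow> B4 i q = B3 i q"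
      "\<And>i j. i \<in> {l<..<m} \<Longrightarrow> j \<in> {l<..<n} \<Longrightarrow> (B4 l j) divides (B3 i j)"
      by (rule row_divides_diagonal_block[OF c3 m, of n]) (use B3(2) in auto)
    note c4 = carrier[OF B4(1) c3]
    obtain B5 where B5: "elem_equiv l m n B4 B5"
      "\<And>j. j \<in> {l..<n} \<Longrightarrow> (B5 l l) divides (B4 l j)"
      by (rule row_gcd[OF c4 n, of m]) blast
    note c5 = carrier[OF B5(1) c4]
    let ?d = "B5 l l"
    have d: "?d \<in> carrier R" by (rule carrier_matD[OF c5])
    have "?d divides (B4 i j)" if ij: "i \<in> {l..<m}" "j \<in> {l..<n}" for i j
    proof (cases "i = l")
      case True
      then show ?thesis using B5(2) ij by simp
    next
      case i: False
      show ?thesis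
      proof (cases "j = l")
        case True
        then have "B4 i j = \<zero>" using B4(2)[OF i] B3l ij i by simp
        then show ?thesis using d by (intro dividesI[of \<zero>]) simp_all
      next
        case False
        then have "(B4 l j) divides (B4 i j)" using B4(2)[OF i] B4(3)[of i j] ij i by simp
        then show ?thesis using divides_trans[OF B5(2)[OF ij(2)]] d carrier_matD[OF c4] by blast
      qed
    qed
    then have div5: "?d divides (B5 i j)" if "i \<in> {l..<m}" "j \<in> {l..<n}" for i j
      using elem_equiv_divides[OF B5(1) d] that by blast
    obtain B6 where B6: "elem_equiv l m n B5 B6" "\<And>q. B6 l q = B5 l q"
      "\<And>i. i \<in> {l<..<m} \<Longrightarrow> B6 i l = \<zero>"
      by (rule clear_column[OF c5 m, of n]) (use div5 n in auto)
    note c6 = carrier[OF B6(1) c5]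
    \<comment> \<open>Clearing the column left row \<open>l\<close> intact, so the pivot still
      divides it; clearing the row in turn leaves column \<open>l\<close> intact.\<close>
    obtain B7 where B7: "elem_equiv l m n B6 B7" "\<And>p. B7 p l = B6 p l"
      "\<And>j. j \<in> {l<..<n} \<Longrightarrow> B7 l j = \<zero>"
      by (rule clear_row[OF c6 n, of m]) (use div5 m B6(2) in auto)
    note c7 = carrier[OF B7(1) c6]
    obtain B8 where B8: "elem_equiv (Suc l) m n B7 B8"
      "\<forall>i\<in>{Suc l..<m}. \<forall>j\<in>{Suc l..<n}. i \<noteq> j \<longrightarrow> B8 i j = \<zero>"
      using Suc.hyps(1)[OF k c7] by auto
    have "elem_equiv l m n A B8"
      using B1(1) B2(1) B3(1) B4(1) B5(1) B6(1) B7(1) B8(1)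
      by (meson elem_equiv_trans elem_equiv_mono le_SucI order_refl)
    moreover have "B8 i j = \<zero>" if ij: "i \<in> {l..<m}" "j \<in> {l..<n}" "i \<noteq> j" for i j
    proof -
      consider "i = l" "j \<in> {l<..<n}" | "j = l" "i \<in> {l<..<m}"
        | "i \<in> {Suc l..<m}" "j \<in> {Suc l..<n}"
        using ij by (cases "i = l"; cases "j = l") auto
      then show ?thesis
      proof cases
        case 1
        then show ?thesis using elem_equiv_Suc_row_zero[OF B8(1) c7 B7(3)] by simp
      next
        case 2
        then show ?thesis
          using elem_equiv_Suc_column_zero[OF B8(1) c7, of i] B7(2) B6(3) by simp
      next
        case 3
        then show ?thesis using B8(2) ij(3) by blast
      qed
    qed
    ultimately show ?thesis by blast
  qed
qed

end

section \<open>Presentations of modules\<close>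

text \<open>An elementary operation alters one summand of a combination of rows or generators; this
  isolates its effect.\<close>

lemma (in abelian_monoid) finsum_add_at:
  assumes "finite S" "k \<in> S" "f \<in> S \<rightarrow> carrier G" "y \<in> carrier G"
    and g: "\<And>j. j \<in> S \<Longrightarrow> g j = (if j = k then f j \<oplus> y else f j)"
  shows "finsum G g S = finsum G f S \<oplus> y"
proof -
  have split: "finsum G h S = h k \<oplus> finsum G h (S - {k})" if "h \<in> S \<rightarrow> carrier G" for h
  proof -
    have "finsum G h (insert k (S - {k})) = h k \<oplus> finsum G h (S - {k})"
      using that assms(1,2) by (intro finsum_insert) auto
    then show ?thesis using assms(2) by (simp add: insert_absorb)
  qed
  have f: "f k \<in> carrier G" "f \<in> S - {k} \<rightarrow> carrier G" using assms(2,3) by auto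
  have gS: "g \<in> S \<rightarrow> carrier G"
  proof
    fix j assume j: "j \<in> S"
    then have "f j \<in> carrier G" using assms(3) by auto
    then show "g j \<in> carrier G" using g[OF j] assms(4) by auto
  qed
  have eq: "finsum G g (S - {k}) = finsum G f (S - {k})"
    using f(2) g by (intro finsum_cong') auto
  have "finsum G g S = (f k \<oplus> y) \<oplus> finsum G f (S - {k})"
    unfolding split[OF gS] eq using g[OF assms(2)] by simp
  also have "\<dots> = (f k \<oplus> finsum G f (S - {k})) \<oplus> y"
    using f assms(4) finsum_closed[OF f(2)] by (simp add: a_ac)
  finally show ?thesis unfolding split[OF assms(3)] .
qed

lemma (in abelian_monoid) finsum_single:
  assumes "finite S" "k \<in> S" "y \<in> carrier G" "\<And>j. j \<in> S \<Longrightarrow> g j = (if j = k then y else \<zero>)"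
  shows "finsum G g S = y"
  using finsum_add_at[of S k "\<lambda>_. \<zero>" y g] assms by simp

section \<open>Row spans under elementary operations\<close>

context cring
begin

text \<open>Vectors are functions on the natural numbers of which only the values below
  \<open>n\<close> are constrained.\<close>

definition row_span :: "nat \<Rightarrow> nat \<Rightarrow> (nat \<Rightarrow> nat \<Rightarrow> 'a) \<Rightarrow> (nat \<Rightarrow> 'a) set" where
  "row_span m n A = {c. \<exists>t\<in>{..<m} \<rightarrow> carrier R. \<forall>j<n. c j = (\<Oplus>i\<in>{..<m}. t i \<otimes> A i j)}"

lemma row_span_add_row_subset:
  assumes A: "carrier_mat A" and ik: "i < m" "k < m" "i \<noteq> k" and s: "s \<in> carrier R"
  shows "row_span m n (add_row i k s A) \<subseteq> row_span m n A"
proof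
  fix c assume "c \<in> row_span m n (add_row i k s A)"
  then obtain t where t: "t \<in> {..<m} \<rightarrow> carrier R"
    "\<And>j. j < n \<Longrightarrow> c j = (\<Oplus>p\<in>{..<m}. t p \<otimes> add_row i k s A p j)"
    by (auto simp: row_span_def)
  \<comment> \<open>The coefficient of row \<open>k\<close> absorbs the multiple of row
    \<open>k\<close> that the operation put into row \<open>i\<close>.\<close>
  define t' where "t' = t(k := t k \<oplus> s \<otimes> t i)"
  note carr = carrier_matD[OF A] s
  have ti: "t i \<in> carrier R" "t k \<in> carrier R" using t(1) ik by auto
  have t': "t' \<in> {..<m} \<rightarrow> carrier R" using t(1) ti s by (auto simp: t'_def)
  have "c j = (\<Oplus>p\<in>{..<m}. t' p \<otimes> A p j)" if "j < n" for j
  proof -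
    have "c j = (\<Oplus>p\<in>{..<m}. t p \<otimes> A p j) \<oplus> s \<otimes> t i \<otimes> A k j"
      unfolding t(2)[OF that]
      by (rule finsum_add_at[where k = i])
        (use t(1) carr ti ik in \<open>auto simp: add_row_def r_distr m_ac\<close>)
    also have "\<dots> = (\<Oplus>p\<in>{..<m}. t' p \<otimes> A p j)"
      by (rule finsum_add_at[where k = k, symmetric])
        (use t(1) carr ti ik in \<open>auto simp: t'_def l_distr\<close>)
    finally show ?thesis .
  qed
  then show "c \<in> row_span m n A" using t' by (auto simp: row_span_def)
qed

lemma add_row_add_row_uminus:
  assumes "carrier_mat A" "s \<in> carrier R" "i \<noteq> k"
  shows "add_row i k (\<ominus> s) (add_row i k s A) = A"
proof (intro ext)
  fix p q
  have "A i q \<oplus> s \<otimes> A k q \<oplus> \<ominus> s \<otimes> A k q = A i q"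
    using assms(2) carrier_matD[OF assms(1)] by (simp add: a_assoc l_minus r_neg)
  then show "add_row i k (\<ominus> s) (add_row i k s A) p q = A p q"
    using assms(3) by (simp add: add_row_def)
qed

lemma add_col_add_col_uminus:
  assumes "carrier_mat A" "s \<in> carrier R" "i \<noteq> k"
  shows "add_col i k (\<ominus> s) (add_col i k s A) = A"
proof (intro ext)
  fix p q
  have "A p i \<oplus> s \<otimes> A p k \<oplus> \<ominus> s \<otimes> A p k = A p i"
    using assms(2) carrier_matD[OF assms(1)] by (simp add: a_assoc l_minus r_neg)
  then show "add_col i k (\<ominus> s) (add_col i k s A) p q = A p q"
    using assms(3) by (simp add: add_col_def)
qed

text \<open>The reverse inclusion is the first one for the inverse operation, which subtracts the
  same multiple.\<close>

lemma row_span_add_row: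
  assumes "carrier_mat A" "i < m" "k < m" "i \<noteq> k" "s \<in> carrier R"
  shows "row_span m n (add_row i k s A) = row_span m n A"
proof
  have "row_span m n (add_row i k (\<ominus> s) (add_row i k s A)) \<subseteq> row_span m n (add_row i k s A)"
    using assms by (intro row_span_add_row_subset carrier_mat_add_row) auto
  then show "row_span m n A \<subseteq> row_span m n (add_row i k s A)"
    using assms by (simp add: add_row_add_row_uminus)
qed (rule row_span_add_row_subset[OF assms])

text \<open>The coefficients stay the same: a column operation acts on each row by one linear rule,
  hence on each combination of rows.\<close>

lemma row_span_add_col:
  assumes A: "carrier_mat A" and ik: "i < n" "k < n" "i \<noteq> k" and s: "s \<in> carrier R"
    and c: "c \<in> row_span m n A"
  shows "c(i := c i \<oplus> s \<otimes> c k) \<in> row_span m n (add_col i k s A)"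
proof -
  obtain t where t: "t \<in> {..<m} \<rightarrow> carrier R"
    "\<And>j. j < n \<Longrightarrow> c j = (\<Oplus>p\<in>{..<m}. t p \<otimes> A p j)"
    using c by (auto simp: row_span_def)
  note carr = carrier_matD[OF A] s
  have mem: "t p \<in> carrier R" if "p < m" for p using t(1) that by auto
  have "c i \<oplus> s \<otimes> c k = (\<Oplus>p\<in>{..<m}. t p \<otimes> A p i) \<oplus> (\<Oplus>p\<in>{..<m}. s \<otimes> (t p \<otimes> A p k))"
    unfolding t(2)[OF ik(1)] t(2)[OF ik(2)]
    using s mem carr by (subst finsum_rdistr) auto
  also have "\<dots> = (\<Oplus>p\<in>{..<m}. t p \<otimes> A p i \<oplus> s \<otimes> (t p \<otimes> A p k))"
    using s mem carr by (intro finsum_addf[symmetric]) auto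
  also have "\<dots> = (\<Oplus>p\<in>{..<m}. t p \<otimes> add_col i k s A p i)"
    using s mem carr by (intro finsum_cong') (auto simp: add_col_def r_distr m_ac)
  finally show ?thesis
    using t by (auto simp: row_span_def add_col_def)
qed

text \<open>Coordinate \<open>k\<close> of a combination comes from row \<open>k\<close> alone, so
  dropping the other rows isolates it.\<close>

lemma row_span_diagonal:
  assumes diag: "\<And>i j. i < m \<Longrightarrow> j < n \<Longrightarrow> i \<noteq> j \<Longrightarrow> A i j = \<zero>" and A: "carrier_mat A"
    and c: "c \<in> row_span m n A" and k: "k < n"
  shows "(\<lambda>j. if j = k then c j else \<zero>) \<in> row_span m n A"
proof -
  obtain t where t: "t \<in> {..<m} \<rightarrow> carrier R"
    "\<And>j. j < n \<Longrightarrow> c j = (\<Oplus>p\<in>{..<m}. t p \<otimes> A p j)"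
    using c by (auto simp: row_span_def)
  have mem: "t p \<in> carrier R" if "p < m" for p using t(1) that by auto
  \<comment> \<open>If \<open>k \<ge> m\<close>, all coefficients below \<open>m\<close> become
    zero, in accordance with column \<open>k\<close> being zero.\<close>
  let ?t = "\<lambda>p. if p = k then t p else \<zero>"
  have "(if j = k then c j else \<zero>) = (\<Oplus>p\<in>{..<m}. ?t p \<otimes> A p j)" if j: "j < n" for j
  proof (cases "j = k")
    case True
    have "(\<Oplus>p\<in>{..<m}. t p \<otimes> A p j) = (\<Oplus>p\<in>{..<m}. ?t p \<otimes> A p j)"
      using mem carrier_matD[OF A] diag[of _ j] j True by (intro finsum_cong') auto
    then show ?thesis using True t(2)[OF j] by simp
  next
    case False
    have "(\<Oplus>p\<in>{..<m}. ?t p \<otimes> A p j) = (\<Oplus>p\<in>{..<m}. \<zero>)"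
      using mem carrier_matD[OF A] diag[of k j] j False by (intro finsum_cong') auto
    then show ?thesis using False by simp
  qed
  moreover have "?t \<in> {..<m} \<rightarrow> carrier R" using mem by auto
  ultimately show ?thesis unfolding row_span_def by (intro CollectI bexI[of _ ?t] allI impI)
qed

end

section \<open>Generators and relations in a module\<close>

context module
begin

definition lin_comb where
  "lin_comb n c g = (\<Oplus>\<^bsub>M\<^esub>i\<in>{..<n::nat}. c i \<odot>\<^bsub>M\<^esub> g i)"

text \<open>\<open>M\<close> is \<open>R^n\<close> modulo the row span of the m by n matrix
  \<open>A\<close>: the rows generate the relations among the generators \<open>g\<close>.\<close>

definition presents where
  "presents m n g A \<longleftrightarrow> g \<in> {..<n} \<rightarrow> carrier M \<and>
    (\<forall>x\<in>carrier M. \<exists>c\<in>{..<n} \<rightarrow> carrier R. x = lin_comb n c g) \<and>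
    (\<forall>c\<in>{..<n} \<rightarrow> carrier R. lin_comb n c g = \<zero>\<^bsub>M\<^esub> \<longleftrightarrow> c \<in> row_span m n A)"

text \<open>Unlike linear independence, this allows torsion: only the terms of a relation vanish, not its
  coefficients.\<close>

definition independent where
  "independent n g \<longleftrightarrow> (\<forall>c\<in>{..<n} \<rightarrow> carrier R. lin_comb n c g = \<zero>\<^bsub>M\<^esub> \<longrightarrow>
    (\<forall>k<n. c k \<odot>\<^bsub>M\<^esub> g k = \<zero>\<^bsub>M\<^esub>))"

lemma lin_comb_closed [simp]:
  "c \<in> {..<n} \<rightarrow> carrier R \<Longrightarrow> g \<in> {..<n} \<rightarrow> carrier M \<Longrightarrow> lin_comb n c g \<in> carrier M"
  unfolding lin_comb_def by (intro M.finsum_closed) auto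

lemma lin_comb_cong:
  assumes "c \<in> {..<n} \<rightarrow> carrier R" "g \<in> {..<n} \<rightarrow> carrier M" "\<And>i. i < n \<Longrightarrow> c' i = c i"
  shows "lin_comb n c' g = lin_comb n c g"
  unfolding lin_comb_def using assms by (intro M.finsum_cong') auto

lemma lin_comb_add:
  assumes "c \<in> {..<n} \<rightarrow> carrier R" "c' \<in> {..<n} \<rightarrow> carrier R" "g \<in> {..<n} \<rightarrow> carrier M"
  shows "lin_comb n (\<lambda>i. c i \<oplus> c' i) g = lin_comb n c g \<oplus>\<^bsub>M\<^esub> lin_comb n c' g"
proof -
  have mem: "c i \<in> carrier R" "c' i \<in> carrier R" "g i \<in> carrier M" if "i < n" for i
    using assms that by auto
  have "lin_comb n (\<lambda>i. c i \<oplus> c' i) g = (\<Oplus>\<^bsub>M\<^esub>i\<in>{..<n}. c i \<odot>\<^bsub>M\<^esub> g i \<oplus>\<^bsub>M\<^esub> c' i \<odot>\<^bsub>M\<^esub> g i)"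
    unfolding lin_comb_def
  proof (rule M.finsum_cong'[OF HOL.refl])
    fix i assume "i \<in> {..<n}"
    then have "c i \<in> carrier R" "c' i \<in> carrier R" "g i \<in> carrier M" using mem by auto
    then show "(c i \<oplus> c' i) \<odot>\<^bsub>M\<^esub> g i = c i \<odot>\<^bsub>M\<^esub> g i \<oplus>\<^bsub>M\<^esub> c' i \<odot>\<^bsub>M\<^esub> g i"
      by (rule smult_l_distr)
  qed (use mem in auto)
  also have "\<dots> = lin_comb n c g \<oplus>\<^bsub>M\<^esub> lin_comb n c' g"
    unfolding lin_comb_def using mem by (intro M.finsum_addf) auto
  finally show ?thesis .
qed

lemma lin_comb_smult:
  assumes "r \<in> carrier R" "c \<in> {..<n} \<rightarrow> carrier R" "g \<in> {..<n} \<rightarrow> carrier M"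
  shows "lin_comb n (\<lambda>i. r \<otimes> c i) g = r \<odot>\<^bsub>M\<^esub> lin_comb n c g"
proof -
  have "r \<odot>\<^bsub>M\<^esub> lin_comb n c g = (\<Oplus>\<^bsub>M\<^esub>i\<in>{..<n}. r \<odot>\<^bsub>M\<^esub> (c i \<odot>\<^bsub>M\<^esub> g i))"
    unfolding lin_comb_def using assms by (intro finsum_smult_ldistr) auto
  also have "\<dots> = lin_comb n (\<lambda>i. r \<otimes> c i) g"
    unfolding lin_comb_def
  proof (rule M.finsum_cong'[OF HOL.refl])
    fix i assume "i \<in> {..<n}"
    then have "c i \<in> carrier R" "g i \<in> carrier M" using assms by auto
    then show "r \<odot>\<^bsub>M\<^esub> (c i \<odot>\<^bsub>M\<^esub> g i) = (r \<otimes> c i) \<odot>\<^bsub>M\<^esub> g i"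
      using assms(1) by (simp add: smult_assoc1)
  qed (use assms in auto)
  finally show ?thesis by simp
qed

lemma lin_comb_single:
  assumes "k < n" "r \<in> carrier R" "g \<in> {..<n} \<rightarrow> carrier M"
  shows "lin_comb n (\<lambda>j. if j = k then r else \<zero>) g = r \<odot>\<^bsub>M\<^esub> g k"
  unfolding lin_comb_def
proof (rule M.finsum_single[of _ k])
  fix j assume "j \<in> {..<n}"
  then have "g j \<in> carrier M" using assms(3) by auto
  then show "(if j = k then r else \<zero>) \<odot>\<^bsub>M\<^esub> g j = (if j = k then r \<odot>\<^bsub>M\<^esub> g k else \<zero>\<^bsub>M\<^esub>)"
    by simp
qed (use assms in auto)

text \<open>Coordinates and generators change in opposite directions: coordinate \<open>i\<close>
  contributes an extra \<open>s \<otimes> c k\<close> times \<open>g i\<close>, and the new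
  generator \<open>k\<close> takes it away.\<close>

lemma lin_comb_add_col:
  assumes ik: "i < n" "k < n" "i \<noteq> k" and s: "s \<in> carrier R"
    and c: "c \<in> {..<n} \<rightarrow> carrier R" and g: "g \<in> {..<n} \<rightarrow> carrier M"
  shows "lin_comb n (c(i := c i \<oplus> s \<otimes> c k)) (g(k := g k \<oplus>\<^bsub>M\<^esub> \<ominus>\<^bsub>M\<^esub> (s \<odot>\<^bsub>M\<^esub> g i))) = lin_comb n c g"
proof -
  let ?c = "c(i := c i \<oplus> s \<otimes> c k)"
  let ?y = "s \<odot>\<^bsub>M\<^esub> g i"
  have cm: "c j \<in> carrier R" and gm: "g j \<in> carrier M" if "j < n" for j
    using c g that by auto
  have "lin_comb n ?c (g(k := g k \<oplus>\<^bsub>M\<^esub> \<ominus>\<^bsub>M\<^esub> ?y)) = lin_comb n ?c g \<oplus>\<^bsub>M\<^esub> \<ominus>\<^bsub>M\<^esub> ((s \<otimes> c k) \<odot>\<^bsub>M\<^esub> g i)"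
    unfolding lin_comb_def
    by (rule M.finsum_add_at[where k = k])
      (use ik s cm gm in \<open>auto simp: smult_r_distr smult_r_minus smult_assoc1[symmetric] R.m_comm\<close>)
  moreover have "lin_comb n ?c g = lin_comb n c g \<oplus>\<^bsub>M\<^esub> (s \<otimes> c k) \<odot>\<^bsub>M\<^esub> g i"
    unfolding lin_comb_def
    by (rule M.finsum_add_at[where k = i])
      (use ik s cm gm in \<open>auto simp: smult_l_distr\<close>)
  ultimately show ?thesis
    using lin_comb_closed[OF c g] s cm gm ik by (simp add: M.a_assoc M.r_neg)
qed

lemma presents_add_row:
  assumes "presents m n g A" "carrier_mat A" "i < m" "k < m" "i \<noteq> k" "s \<in> carrier R"
  shows "presents m n g (add_row i k s A)"
  using assms(1) unfolding presents_def row_span_add_row[OF assms(2-6)] .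

text \<open>A column operation is an invertible change of coordinates on the relations; the
  generators undergo the compensating change.\<close>

lemma presents_add_col:
  assumes pres: "presents m n g A" and A: "carrier_mat A"
    and ik: "i < n" "k < n" "i \<noteq> k" and s: "s \<in> carrier R"
  shows "presents m n (g(k := g k \<oplus>\<^bsub>M\<^esub> \<ominus>\<^bsub>M\<^esub> (s \<odot>\<^bsub>M\<^esub> g i))) (add_col i k s A)"
proof -
  let ?A = "add_col i k s A"
  let ?g = "g(k := g k \<oplus>\<^bsub>M\<^esub> \<ominus>\<^bsub>M\<^esub> (s \<odot>\<^bsub>M\<^esub> g i))"
  let ?T = "\<lambda>s c. c(i := c i \<oplus> s \<otimes> c k)"
  have g: "g \<in> {..<n} \<rightarrow> carrier M" using pres by (simp add: presents_def)
  then have gm: "g j \<in> carrier M" if "j < n" for j using that by auto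
  have T: "?T r c \<in> {..<n} \<rightarrow> carrier R" if "c \<in> {..<n} \<rightarrow> carrier R" "r \<in> carrier R" for c r
  proof -
    have "c i \<in> carrier R" "c k \<in> carrier R" using that(1) ik by auto
    then show ?thesis using that by (auto simp: Pi_def)
  qed
  have TT: "?T s (?T (\<ominus> s) c) = c" "?T (\<ominus> s) (?T s c) = c"
    if c: "c \<in> {..<n} \<rightarrow> carrier R" for c
  proof -
    have "c i \<in> carrier R" "c k \<in> carrier R" using c ik by auto
    then have "c i \<oplus> \<ominus> s \<otimes> c k \<oplus> s \<otimes> c k = c i" "c i \<oplus> s \<otimes> c k \<oplus> \<ominus> s \<otimes> c k = c i"
      using s by (simp_all add: R.a_assoc R.l_minus R.l_neg R.r_neg)
    then show "?T s (?T (\<ominus> s) c) = c" "?T (\<ominus> s) (?T s c) = c" using ik(3) by auto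
  qed
  have "?g \<in> {..<n} \<rightarrow> carrier M" using gm ik s by auto
  moreover have "\<exists>c\<in>{..<n} \<rightarrow> carrier R. x = lin_comb n c ?g" if x: "x \<in> carrier M" for x
  proof -
    obtain c where c: "c \<in> {..<n} \<rightarrow> carrier R" "x = lin_comb n c g"
      using pres x unfolding presents_def by auto
    then show ?thesis using lin_comb_add_col[OF ik s c(1) g] T[OF c(1) s] by metis
  qed
  moreover have "lin_comb n c ?g = \<zero>\<^bsub>M\<^esub> \<longleftrightarrow> c \<in> row_span m n ?A"
    if c: "c \<in> {..<n} \<rightarrow> carrier R" for c
  proof -
    \<comment> \<open>Pulling \<open>c\<close> back through the inverse change of coordinates leads
      to the old generators and the old matrix.\<close>
    let ?c = "?T (\<ominus> s) c"
    have c': "?c \<in> {..<n} \<rightarrow> carrier R" using T[OF c] s by simp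
    have "lin_comb n c ?g = lin_comb n ?c g"
      using lin_comb_add_col[OF ik s c' g] unfolding TT(1)[OF c] .
    moreover have "c \<in> row_span m n ?A" if "?c \<in> row_span m n A"
      using row_span_add_col[OF A ik s that] unfolding TT(1)[OF c] .
    moreover have "?c \<in> row_span m n A" if "c \<in> row_span m n ?A"
      using row_span_add_col[OF carrier_mat_add_col[OF A s] ik R.a_inv_closed[OF s] that]
      unfolding add_col_add_col_uminus[OF A s ik(3)] .
    ultimately show ?thesis using pres c' unfolding presents_def by auto
  qed
  ultimately show ?thesis unfolding presents_def by simp
qed

lemma presents_elem_equiv:
  assumes "elem_equiv l m n A B" "carrier_mat A" "presents m n g A"
  shows "\<exists>g'. presents m n g' B"
  using assms
proof (induction rule: elem_equiv.induct)
  case refl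
  then show ?case by blast
next
  case (row B i k s)
  then show ?case
    using presents_add_row[of m n _ B i k s] elem_equiv_carrier_mat[OF row.hyps(1)] by auto
next
  case (col B i k s)
  then obtain g' where "presents m n g' B" by blast
  from presents_add_col[OF this, of i k s] col show ?case
    using elem_equiv_carrier_mat[OF col.hyps(1)] by auto
qed

text \<open>By \<open>row_span_diagonal\<close>, the part of a relation at coordinate
  \<open>k\<close> is itself a relation, and it has the single term \<open>c k\<close> times
  \<open>g k\<close>.\<close>

lemma presents_diagonal_independent:
  assumes pres: "presents m n g A" and A: "carrier_mat A"
    and diag: "\<And>i j. i < m \<Longrightarrow> j < n \<Longrightarrow> i \<noteq> j \<Longrightarrow> A i j = \<zero>"
  shows "independent n g"
  unfolding independent_def
proof (intro ballI allI impI)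
  fix c k assume c: "c \<in> {..<n} \<rightarrow> carrier R" "lin_comb n c g = \<zero>\<^bsub>M\<^esub>" and k: "k < n"
  have ck: "c k \<in> carrier R" using c(1) k by auto
  let ?c = "\<lambda>j. if j = k then c k else \<zero>"
  have c': "?c \<in> {..<n} \<rightarrow> carrier R" using ck by auto
  have "c \<in> row_span m n A" using pres c by (simp add: presents_def)
  from row_span_diagonal[OF diag A this k] have "?c \<in> row_span m n A"
    by (simp cong: if_cong)
  then have "lin_comb n ?c g = \<zero>\<^bsub>M\<^esub>" using pres c' by (simp add: presents_def)
  then show "c k \<odot>\<^bsub>M\<^esub> g k = \<zero>\<^bsub>M\<^esub>"
    using lin_comb_single[OF k ck] pres by (simp add: presents_def)
qed

section \<open>Spans and direct sums of cyclic submodules\<close>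

lemma submodule_span_image:
  assumes h: "h \<in> {..<m::nat} \<rightarrow> carrier M"
  shows "submodule_span R M (h ` {..<m}) = {lin_comb m t h | t. t \<in> {..<m} \<rightarrow> carrier R}"
    (is "_ = ?S")
proof
  have hm: "h i \<in> carrier M" if "i < m" for i using h that by auto
  have "submodule ?S R M"
  proof (rule submoduleI)
    show "?S \<subseteq> carrier M" using h by auto
    have zero: "lin_comb m (\<lambda>_. \<zero>) h = \<zero>\<^bsub>M\<^esub>"
    proof -
      have "lin_comb m (\<lambda>_. \<zero>) h = (\<Oplus>\<^bsub>M\<^esub>i\<in>{..<m}. \<zero>\<^bsub>M\<^esub>)"
        unfolding lin_comb_def using hm by (intro M.finsum_cong') auto
      then show ?thesis by simp
    qed
    show "\<zero>\<^bsub>M\<^esub> \<in> ?S" by (intro CollectI exI[of _ "\<lambda>_. \<zero>"]) (simp add: zero)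
    show smult: "r \<odot>\<^bsub>M\<^esub> x \<in> ?S" if r: "r \<in> carrier R" and x: "x \<in> ?S" for r x
    proof -
      obtain t where t: "t \<in> {..<m} \<rightarrow> carrier R" "x = lin_comb m t h" using x by auto
      then show ?thesis
        using lin_comb_smult[OF r t(1) h] r
        by (intro CollectI exI[of _ "\<lambda>i. r \<otimes> t i"]) (auto simp: Pi_def)
    qed
    show "\<ominus>\<^bsub>M\<^esub> x \<in> ?S" if "x \<in> ?S" for x
    proof -
      have "x \<in> carrier M" using that h by auto
      then show ?thesis using smult[of "\<ominus> \<one>" x] that by (simp add: smult_l_minus)
    qed
    show "x \<oplus>\<^bsub>M\<^esub> y \<in> ?S" if x: "x \<in> ?S" and y: "y \<in> ?S" for x y
    proof -
      obtain t t' where t: "t \<in> {..<m} \<rightarrow> carrier R" "x = lin_comb m t h"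
        "t' \<in> {..<m} \<rightarrow> carrier R" "y = lin_comb m t' h" using x y by auto
      then show ?thesis
        using lin_comb_add[OF t(1,3) h]
        by (intro CollectI exI[of _ "\<lambda>i. t i \<oplus> t' i"]) (auto simp: Pi_def)
    qed
  qed
  moreover have "h ` {..<m} \<subseteq> ?S"
  proof
    fix x assume "x \<in> h ` {..<m}"
    then obtain i where i: "i < m" "x = h i" by auto
    then have "x = lin_comb m (\<lambda>j. if j = i then \<one> else \<zero>) h"
      using lin_comb_single[OF i(1) one_closed h] hm by simp
    then show "x \<in> ?S" by (intro CollectI exI[of _ "\<lambda>j. if j = i then \<one> else \<zero>"]) auto
  qed
  ultimately show "submodule_span R M (h ` {..<m}) \<subseteq> ?S"
    unfolding submodule_span_def by (intro Inter_lower) simp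
next
  show "?S \<subseteq> submodule_span R M (h ` {..<m})"
    unfolding submodule_span_def
  proof (intro Inter_greatest subsetI)
    fix N x assume N: "N \<in> {N. submodule N R M \<and> h ` {..<m} \<subseteq> N}" and "x \<in> ?S"
    then obtain t where t: "t \<in> {..<m} \<rightarrow> carrier R" "x = lin_comb m t h" by auto
    interpret N: submodule N R M using N by simp
    have sub: "N \<subseteq> carrier M" using N submoduleE(1) by auto
    have hN: "t i \<odot>\<^bsub>M\<^esub> h i \<in> N" if "i < m" for i using N t(1) that by auto
    have "(\<Oplus>\<^bsub>M\<^esub>i\<in>{..<r}. t i \<odot>\<^bsub>M\<^esub> h i) \<in> N" if "r \<le> m" for r
      using that
    proof (induction r)
      case 0
      show ?case using N.one_closed by simp
    next
      case (Suc r)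
      have "(\<Oplus>\<^bsub>M\<^esub>i\<in>{..<Suc r}. t i \<odot>\<^bsub>M\<^esub> h i) =
          t r \<odot>\<^bsub>M\<^esub> h r \<oplus>\<^bsub>M\<^esub> (\<Oplus>\<^bsub>M\<^esub>i\<in>{..<r}. t i \<odot>\<^bsub>M\<^esub> h i)"
        unfolding lessThan_Suc using hN sub Suc.prems by (intro M.finsum_insert) auto
      then show ?case using submoduleE(5)[OF N.submodule_axioms] hN[of r] Suc by simp
    qed
    then show "x \<in> N" using t(2) unfolding lin_comb_def by simp
  qed
qed

lemma submodule_span_submodule:
  assumes "X \<subseteq> carrier M"
  shows "submodule (submodule_span R M X) R M"
proof (rule submoduleI)
  show "submodule_span R M X \<subseteq> carrier M"
    unfolding submodule_span_def using carrier_is_submodule assms by (intro Inter_lower) simp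
qed (auto simp: submodule_span_def dest: submoduleE submodule.smult_closed
    subgroup.one_closed[OF submodule.axioms(1)])

lemma submodule_span_singleton:
  assumes "x \<in> carrier M"
  shows "submodule_span R M {x} = {r \<odot>\<^bsub>M\<^esub> x | r. r \<in> carrier R}"
proof -
  have lin_comb_1: "lin_comb 1 t (\<lambda>_. x) = t 0 \<odot>\<^bsub>M\<^esub> x" if "t \<in> {..<1} \<rightarrow> carrier R" for t
    unfolding lin_comb_def using that assms by (intro M.finsum_single[of _ 0]) auto
  have "{lin_comb 1 t (\<lambda>_. x) | t. t \<in> {..<1} \<rightarrow> carrier R} =
      (\<lambda>t. lin_comb 1 t (\<lambda>_. x)) ` ({..<1} \<rightarrow> carrier R)" by (rule Setcompr_eq_image)
  also have "\<dots> = (\<lambda>t. t 0 \<odot>\<^bsub>M\<^esub> x) ` ({..<1::nat} \<rightarrow> carrier R)"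
    by (rule image_cong[OF HOL.refl lin_comb_1])
  also have "\<dots> = {r \<odot>\<^bsub>M\<^esub> x | r. r \<in> carrier R}"
  proof (intro equalityI subsetI)
    fix y assume "y \<in> {r \<odot>\<^bsub>M\<^esub> x | r. r \<in> carrier R}"
    then obtain r where "y = r \<odot>\<^bsub>M\<^esub> x" "r \<in> carrier R" by auto
    then show "y \<in> (\<lambda>t. t 0 \<odot>\<^bsub>M\<^esub> x) ` ({..<1::nat} \<rightarrow> carrier R)"
      by (intro image_eqI[of _ _ "\<lambda>_. r"]) auto
  qed auto
  finally show ?thesis
    using submodule_span_image[of "\<lambda>_. x" 1] assms by (auto simp: lessThan_Suc)
qed

text \<open>With \<open>y i\<close> and \<open>z i\<close> written as multiples of
  \<open>g i\<close>, the differences of the coefficients form a relation, and independence makes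
  each of its terms vanish.\<close>

lemma independent_generators_sum_eqD:
  assumes g: "g \<in> {..<n} \<rightarrow> carrier M"
    and indep: "independent n g"
    and y: "\<And>i. i < n \<Longrightarrow> y i \<in> submodule_span R M {g i}"
    and z: "\<And>i. i < n \<Longrightarrow> z i \<in> submodule_span R M {g i}"
    and eq: "(\<Oplus>\<^bsub>M\<^esub>i\<in>{..<n::nat}. y i) = (\<Oplus>\<^bsub>M\<^esub>i\<in>{..<n}. z i)" and k: "k < n"
  shows "y k = z k"
proof -
  have gm: "g i \<in> carrier M" if "i < n" for i using g that by auto
  have "\<exists>r\<in>carrier R. y i = r \<odot>\<^bsub>M\<^esub> g i" if "i < n" for i
    using y[OF that] unfolding submodule_span_singleton[OF gm[OF that]] by auto
  then obtain a where a: "\<And>i. i < n \<Longrightarrow> a i \<in> carrier R" "\<And>i. i < n \<Longrightarrow> y i = a i \<odot>\<^bsub>M\<^esub> g i"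
    by metis
  have "\<exists>r\<in>carrier R. z i = r \<odot>\<^bsub>M\<^esub> g i" if "i < n" for i
    using z[OF that] unfolding submodule_span_singleton[OF gm[OF that]] by auto
  then obtain b where b: "\<And>i. i < n \<Longrightarrow> b i \<in> carrier R" "\<And>i. i < n \<Longrightarrow> z i = b i \<odot>\<^bsub>M\<^esub> g i"
    by metis
  have ab: "a \<in> {..<n} \<rightarrow> carrier R" "b \<in> {..<n} \<rightarrow> carrier R"
    "(\<lambda>i. \<ominus> \<one> \<otimes> b i) \<in> {..<n} \<rightarrow> carrier R"
    and ab': "(\<lambda>i. a i \<oplus> \<ominus> \<one> \<otimes> b i) \<in> {..<n} \<rightarrow> carrier R"
    using a(1) b(1) by auto
  have "lin_comb n a g = (\<Oplus>\<^bsub>M\<^esub>i\<in>{..<n}. y i)" "lin_comb n b g = (\<Oplus>\<^bsub>M\<^esub>i\<in>{..<n}. z i)"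
    unfolding lin_comb_def using a b gm by (auto intro!: M.finsum_cong')
  then have "lin_comb n a g = lin_comb n b g" using eq by simp
  then have "lin_comb n (\<lambda>i. a i \<oplus> \<ominus> \<one> \<otimes> b i) g = \<zero>\<^bsub>M\<^esub>"
    using lin_comb_add[OF ab(1,3) g] lin_comb_smult[OF _ ab(2) g, of "\<ominus> \<one>"]
      lin_comb_closed[OF ab(2) g]
    by (simp add: smult_l_minus M.r_neg)
  then have "(a k \<oplus> \<ominus> \<one> \<otimes> b k) \<odot>\<^bsub>M\<^esub> g k = \<zero>\<^bsub>M\<^esub>"
    using indep ab' k unfolding independent_def by blast
  then have "y k \<oplus>\<^bsub>M\<^esub> \<ominus>\<^bsub>M\<^esub> z k = \<zero>\<^bsub>M\<^esub>"
    using a[OF k] b[OF k] gm[OF k] by (simp add: smult_l_distr smult_l_minus R.l_minus)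
  then show ?thesis
    using a[OF k] b[OF k] gm[OF k] M.minus_equality[of "y k" "\<ominus>\<^bsub>M\<^esub> z k"] by simp
qed

text \<open>Zero generators are discarded, since a set of submodules cannot contain a submodule twice.\<close>

lemma independent_generators_direct_sum:
  assumes g: "g \<in> {..<n} \<rightarrow> carrier M"
    and gen: "\<And>x. x \<in> carrier M \<Longrightarrow> \<exists>c\<in>{..<n} \<rightarrow> carrier R. x = lin_comb n c g"
    and indep: "independent n g"
  shows "\<exists>\<C>. (\<forall>N\<in>\<C>. cyclic_submodule R M N) \<and> is_direct_sum R M \<C>"
proof -
  note sum_eqD = independent_generators_sum_eqD[OF g indep]
  define N where "N i = submodule_span R M {g i}" for i
  define I where "I = {i. i < n \<and> g i \<noteq> \<zero>\<^bsub>M\<^esub>}"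
  have I: "I \<subseteq> {..<n}" "finite I" by (auto simp: I_def)
  have gm: "g i \<in> carrier M" if "i < n" for i using g that by auto
  have N: "submodule (N i) R M" if "i < n" for i
    unfolding N_def using gm[OF that] by (intro submodule_span_submodule) simp
  have N_carr: "N i \<subseteq> carrier M" if "i < n" for i by (rule submoduleE(1)[OF N[OF that]])
  have N_zero: "\<zero>\<^bsub>M\<^esub> \<in> N i" if "i < n" for i
    using subgroup.one_closed[OF submodule.axioms(1)[OF N[OF that]]] by simp
  have N_gen: "r \<odot>\<^bsub>M\<^esub> g i \<in> N i" if "i < n" "r \<in> carrier R" for i r
    unfolding N_def submodule_span_singleton[OF gm[OF that(1)]] using that(2) by auto
  \<comment> \<open>If two indices gave the same submodule, the nonzero \<open>g i\<close> could be
    placed at either index of a sum, against uniqueness.\<close>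
  have inj: "inj_on N I"
  proof (rule inj_onI, rule ccontr)
    fix i j assume ij: "i \<in> I" "j \<in> I" "N i = N j" "i \<noteq> j"
    then have n: "i < n" "j < n" and gi: "g i \<in> N i" "g i \<in> N j" "g i \<noteq> \<zero>\<^bsub>M\<^esub>"
      using N_gen[of i \<one>] gm by (auto simp: I_def)
    have "(\<Oplus>\<^bsub>M\<^esub>k\<in>{..<n}. if k = l then g i else \<zero>\<^bsub>M\<^esub>) = g i" if "l < n" for l
      using that gm[OF n(1)] by (intro M.finsum_single[of _ l]) auto
    then have "(if i = i then g i else \<zero>\<^bsub>M\<^esub>) = (if i = j then g i else \<zero>\<^bsub>M\<^esub>)"
      using gi n N_zero unfolding N_def
      by (intro sum_eqD[of "\<lambda>k. if k = i then g i else \<zero>\<^bsub>M\<^esub>" "\<lambda>k. if k = j then g i else \<zero>\<^bsub>M\<^esub>"])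
        auto
    then show False using ij(4) gi(3) by simp
  qed
  \<comment> \<open>\<open>ext f\<close> lists a family over submodules along the indices below
    \<open>n\<close>, with zero at discarded generators; since \<open>N\<close> is injective on
    \<open>I\<close>, the sums agree.\<close>
  define ext where "ext f i = (if i \<in> I then f (N i) else \<zero>\<^bsub>M\<^esub>)" for f i
  have ext_mem: "ext f i \<in> N i" if "f \<in> (\<Pi>\<^sub>E X\<in>N ` I. X)" "i < n" for f i
    using that N_zero[OF that(2)] by (auto simp: ext_def)
  have sum_ext: "(\<Oplus>\<^bsub>M\<^esub>X\<in>{X \<in> N ` I. f X \<noteq> \<zero>\<^bsub>M\<^esub>}. f X) = (\<Oplus>\<^bsub>M\<^esub>i\<in>{..<n}. ext f i)"
    if f: "f \<in> (\<Pi>\<^sub>E X\<in>N ` I. X)" for f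
  proof -
    have fN: "f (N i) \<in> carrier M" if "i \<in> I" for i
    proof -
      have "f (N i) \<in> N i" using PiE_mem[OF f imageI[OF that]] .
      then show ?thesis using N_carr[of i] that by (auto simp: I_def)
    qed
    have "(\<Oplus>\<^bsub>M\<^esub>X\<in>{X \<in> N ` I. f X \<noteq> \<zero>\<^bsub>M\<^esub>}. f X) = (\<Oplus>\<^bsub>M\<^esub>X\<in>N ` I. f X)"
      using fN I(2) by (intro M.add.finprod_mono_neutral_cong_left) auto
    also have "\<dots> = (\<Oplus>\<^bsub>M\<^esub>i\<in>I. f (N i))"
      using fN inj by (intro M.finsum_reindex) auto
    also have "\<dots> = (\<Oplus>\<^bsub>M\<^esub>i\<in>{..<n}. ext f i)"
      using fN I by (intro M.add.finprod_mono_neutral_cong_left) (auto simp: ext_def)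
    finally show ?thesis .
  qed
  have "is_direct_sum R M (N ` I)"
    unfolding is_direct_sum_def
  proof (intro conjI ballI)
    show "submodule X R M" if "X \<in> N ` I" for X using that N I by auto
    fix x assume x: "x \<in> carrier M"
    obtain c where c: "c \<in> {..<n} \<rightarrow> carrier R" "x = lin_comb n c g" using gen[OF x] by auto
    \<comment> \<open>Each term of a combination giving \<open>x\<close> is assigned to the
      submodule of its generator; terms with zero generators drop out.\<close>
    define f where "f = (\<lambda>X\<in>N ` I. c (the_inv_into I N X) \<odot>\<^bsub>M\<^esub> g (the_inv_into I N X))"
    have fN: "f (N i) = c i \<odot>\<^bsub>M\<^esub> g i" if "i \<in> I" for i
      using that by (simp add: f_def the_inv_into_f_f[OF inj])
    have cm: "c i \<in> carrier R" if "i < n" for i using c(1) that by auto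
    have f: "f \<in> (\<Pi>\<^sub>E X\<in>N ` I. X)"
    proof (rule PiE_I)
      show "f X \<in> X" if "X \<in> N ` I" for X
        using that fN N_gen cm I(1) by auto
    qed (simp add: f_def)
    have "(\<Oplus>\<^bsub>M\<^esub>i\<in>{..<n}. ext f i) = lin_comb n c g"
      unfolding lin_comb_def using cm gm fN by (intro M.finsum_cong') (auto simp: ext_def I_def)
    then have xf: "x = (\<Oplus>\<^bsub>M\<^esub>X\<in>{X \<in> N ` I. f X \<noteq> \<zero>\<^bsub>M\<^esub>}. f X)" using sum_ext[OF f] c(2) by simp
    show "\<exists>!f. f \<in> (\<Pi>\<^sub>E X\<in>N ` I. X) \<and> finite {X \<in> N ` I. f X \<noteq> \<zero>\<^bsub>M\<^esub>} \<and>
        x = (\<Oplus>\<^bsub>M\<^esub>X\<in>{X \<in> N ` I. f X \<noteq> \<zero>\<^bsub>M\<^esub>}. f X)"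
    proof (rule ex1I[of _ f])
      show "f \<in> (\<Pi>\<^sub>E X\<in>N ` I. X) \<and> finite {X \<in> N ` I. f X \<noteq> \<zero>\<^bsub>M\<^esub>} \<and>
          x = (\<Oplus>\<^bsub>M\<^esub>X\<in>{X \<in> N ` I. f X \<noteq> \<zero>\<^bsub>M\<^esub>}. f X)"
        using f xf I(2) by simp
      fix f' assume f': "f' \<in> (\<Pi>\<^sub>E X\<in>N ` I. X) \<and> finite {X \<in> N ` I. f' X \<noteq> \<zero>\<^bsub>M\<^esub>} \<and>
          x = (\<Oplus>\<^bsub>M\<^esub>X\<in>{X \<in> N ` I. f' X \<noteq> \<zero>\<^bsub>M\<^esub>}. f' X)"
      then have f'E: "f' \<in> (\<Pi>\<^sub>E X\<in>N ` I. X)" by simp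
      have sums: "(\<Oplus>\<^bsub>M\<^esub>i\<in>{..<n}. ext f' i) = (\<Oplus>\<^bsub>M\<^esub>i\<in>{..<n}. ext f i)"
        using f' xf sum_ext[OF f] sum_ext[OF f'E] by simp
      have "ext f' i = ext f i" if "i < n" for i
        by (rule sum_eqD[OF ext_mem[OF f'E, unfolded N_def] ext_mem[OF f, unfolded N_def] sums that])
      then have "f' (N i) = f (N i)" if "i \<in> I" for i
        using that unfolding ext_def I_def by fastforce
      then show "f' = f" by (intro PiE_ext[OF f'E f]) auto
    qed
  qed
  moreover have "\<forall>X\<in>N ` I. cyclic_submodule R M X"
    unfolding cyclic_submodule_def N_def using gm by (auto simp: I_def)
  ultimately show ?thesis by blast
qed

end

section \<open>Matrices from finite presentations\<close>

lemma (in cring) free_module_finsum_apply: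
  assumes "finite S" "\<And>i. i \<in> S \<Longrightarrow> h i \<in> carrier (free_module R n)" "j < n"
  shows "(\<Oplus>\<^bsub>free_module R n\<^esub>i\<in>S. h i) j = (\<Oplus>i\<in>S. h i j)"
proof -
  interpret F: module R "free_module R n" by (rule module_free_module[OF is_cring])
  have carr: "v j \<in> carrier R" if "v \<in> carrier (free_module R n)" for v
    using that assms(3) by (auto simp: free_module_def)
  show ?thesis
    using assms(1,2)
  proof (induction S rule: finite_induct)
    case empty
    have "\<zero>\<^bsub>free_module R n\<^esub> j = \<zero>" using assms(3) by (simp add: free_module_def)
    then show ?case by simp
  next
    case (insert x S)
    then have "(\<Oplus>\<^bsub>free_module R n\<^esub>i\<in>insert x S. h i) =
        h x \<oplus>\<^bsub>free_module R n\<^esub> (\<Oplus>\<^bsub>free_module R n\<^esub>i\<in>S. h i)"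
      by (intro F.M.finsum_insert) auto
    then have "(\<Oplus>\<^bsub>free_module R n\<^esub>i\<in>insert x S. h i) j = h x j \<oplus> (\<Oplus>\<^bsub>free_module R n\<^esub>i\<in>S. h i) j"
      using assms(3) by (simp add: free_module_def)
    also have "\<dots> = h x j \<oplus> (\<Oplus>i\<in>S. h i j)" using insert by simp
    also have "\<dots> = (\<Oplus>i\<in>insert x S. h i j)"
      using insert carr by (intro finsum_insert[symmetric]) auto
    finally show ?case .
  qed
qed

lemma linear_maps_finsum:
  assumes "module R M" "module R N" "f \<in> linear_maps R M N"
    and "finite S" "\<And>i. i \<in> S \<Longrightarrow> h i \<in> carrier M"
  shows "f (\<Oplus>\<^bsub>M\<^esub>i\<in>S. h i) = (\<Oplus>\<^bsub>N\<^esub>i\<in>S. f (h i))"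
proof -
  interpret M: module R M by fact
  interpret N: module R N by fact
  have f: "f \<in> carrier M \<rightarrow> carrier N"
    "\<And>x y. x \<in> carrier M \<Longrightarrow> y \<in> carrier M \<Longrightarrow> f (x \<oplus>\<^bsub>M\<^esub> y) = f x \<oplus>\<^bsub>N\<^esub> f y"
    "\<And>r x. r \<in> carrier R \<Longrightarrow> x \<in> carrier M \<Longrightarrow> f (r \<odot>\<^bsub>M\<^esub> x) = r \<odot>\<^bsub>N\<^esub> f x"
    using assms(3) by (auto simp: linear_maps_def)
  then have fm: "f x \<in> carrier N" if "x \<in> carrier M" for x using that by auto
  \<comment> \<open>Preservation of zero is obtained from homogeneity.\<close>
  have "f (\<zero>\<^bsub>R\<^esub> \<odot>\<^bsub>M\<^esub> \<zero>\<^bsub>M\<^esub>) = \<zero>\<^bsub>R\<^esub> \<odot>\<^bsub>N\<^esub> f \<zero>\<^bsub>M\<^esub>" by (intro f(3)) auto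
  then have zero: "f \<zero>\<^bsub>M\<^esub> = \<zero>\<^bsub>N\<^esub>" using fm by simp
  show ?thesis
    using assms(4,5)
  proof (induction S rule: finite_induct)
    case empty
    then show ?case by (simp add: zero)
  next
    case (insert x S)
    then have h: "h x \<in> carrier M" "h \<in> S \<rightarrow> carrier M" by auto
    have "f (\<Oplus>\<^bsub>M\<^esub>i\<in>insert x S. h i) = f (h x \<oplus>\<^bsub>M\<^esub> (\<Oplus>\<^bsub>M\<^esub>i\<in>S. h i))"
      using insert(1,2) h by simp
    also have "\<dots> = f (h x) \<oplus>\<^bsub>N\<^esub> f (\<Oplus>\<^bsub>M\<^esub>i\<in>S. h i)"
      using h by (intro f(2)) auto
    also have "f (\<Oplus>\<^bsub>M\<^esub>i\<in>S. h i) = (\<Oplus>\<^bsub>N\<^esub>i\<in>S. f (h i))" using insert by simp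
    also have "f (h x) \<oplus>\<^bsub>N\<^esub> (\<Oplus>\<^bsub>N\<^esub>i\<in>S. f (h i)) = (\<Oplus>\<^bsub>N\<^esub>i\<in>insert x S. f (h i))"
      using insert(1,2) h fm by (intro N.M.finsum_insert[symmetric]) auto
    finally show ?case .
  qed
qed

text \<open>The generators are the images of the unit vectors, and the rows of \<open>A\<close> are
  finitely many generators of the kernel.\<close>

lemma (in module) finitely_presented_presents:
  assumes "finitely_presented R M"
  obtains m n g A where "carrier_mat A" "presents m n g A"
proof -
  obtain n f X where f: "f \<in> linear_maps R (free_module R n) M"
    "f ` carrier (free_module R n) = carrier M"
    and X: "finite X" "X \<subseteq> carrier (free_module R n)"
      "{v \<in> carrier (free_module R n). f v = \<zero>\<^bsub>M\<^esub>} = submodule_span R (free_module R n) X"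
    using assms unfolding finitely_presented_def fin_gen_submodule_def by auto
  let ?F = "free_module R n"
  interpret F: module R ?F by (rule module_free_module[OF is_cring])
  obtain h and m :: nat where h: "X = h ` {..<m}"
    using X(1) unfolding finite_conv_nat_seg_image lessThan_def by auto
  have hF: "h \<in> {..<m} \<rightarrow> carrier ?F" using X(2) h by auto
  have app: "v j \<in> carrier R" if "v \<in> carrier ?F" "j < n" for v j
    using that by (auto simp: free_module_def)
  have mem: "restrict c {..<n} \<in> carrier ?F" if "c \<in> {..<n} \<rightarrow> carrier R" for c
    using that by (auto simp: free_module_def)
  have ext: "v = w" if "v \<in> carrier ?F" "w \<in> carrier ?F" "\<And>j. j < n \<Longrightarrow> v j = w j" for v w
    using that by (intro PiE_ext[of v "{..<n}" "\<lambda>_. carrier R" w]) (auto simp: free_module_def)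
  have smult: "(r \<odot>\<^bsub>?F\<^esub> v) j = r \<otimes> v j" if "j < n" for r v j
    using that by (simp add: free_module_def)
  \<comment> \<open>Padding with zero makes \<open>carrier_mat\<close> hold outside the index
    range.\<close>
  define A where "A i j = (if i < m \<and> j < n then h i j else \<zero>)" for i j
  have hm: "h i \<in> carrier ?F" if "i < m" for i using hF that by auto
  have A: "carrier_mat A" using app hm by (auto simp: carrier_mat_def A_def)
  define unit where "unit i = (\<lambda>j\<in>{..<n}. if j = i then \<one> else \<zero>)" for i
  define g where "g i = f (unit i)" for i
  have unit: "unit i \<in> carrier ?F" for i unfolding unit_def by (intro mem) auto
  have fm: "f v \<in> carrier M" if "v \<in> carrier ?F" for v using f(2) that by blast
  have g: "g \<in> {..<n} \<rightarrow> carrier M" using fm unit by (auto simp: g_def)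
  have f_eq: "f v = lin_comb n v g" if v: "v \<in> carrier ?F" for v
  proof -
    have "v = (\<Oplus>\<^bsub>?F\<^esub>i\<in>{..<n}. v i \<odot>\<^bsub>?F\<^esub> unit i)"
    proof (rule ext[OF v])
      show "(\<Oplus>\<^bsub>?F\<^esub>i\<in>{..<n}. v i \<odot>\<^bsub>?F\<^esub> unit i) \<in> carrier ?F"
        using app[OF v] unit by (intro F.M.finsum_closed) auto
      fix j assume j: "j < n"
      have "(\<Oplus>\<^bsub>?F\<^esub>i\<in>{..<n}. v i \<odot>\<^bsub>?F\<^esub> unit i) j = (\<Oplus>i\<in>{..<n}. (v i \<odot>\<^bsub>?F\<^esub> unit i) j)"
        using app[OF v] unit j by (intro free_module_finsum_apply) auto
      also have "\<dots> = v j"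
        using app[OF v] j by (intro R.finsum_single[of _ j]) (auto simp: smult unit_def)
      finally show "v j = (\<Oplus>\<^bsub>?F\<^esub>i\<in>{..<n}. v i \<odot>\<^bsub>?F\<^esub> unit i) j" by simp
    qed
    then have "f v = (\<Oplus>\<^bsub>M\<^esub>i\<in>{..<n}. f (v i \<odot>\<^bsub>?F\<^esub> unit i))"
      using linear_maps_finsum[OF F.module_axioms module_axioms f(1), of "{..<n}"
          "\<lambda>i. v i \<odot>\<^bsub>?F\<^esub> unit i"] app[OF v] unit by simp
    also have "\<dots> = lin_comb n v g"
      unfolding lin_comb_def using f(1) app[OF v] unit fm
      by (intro M.finsum_cong') (auto simp: g_def linear_maps_def)
    finally show ?thesis .
  qed
  \<comment> \<open>Members of the free module are \<open>undefined\<close> outside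
    \<open>{..<n}\<close> while coefficient families are arbitrary there; \<open>restrict\<close>
    mediates, and equality becomes coordinatewise.\<close>
  have span: "(\<exists>t\<in>{..<m} \<rightarrow> carrier R. restrict c {..<n} = F.lin_comb m t h) \<longleftrightarrow> c \<in> row_span m n A"
    if c: "c \<in> {..<n} \<rightarrow> carrier R" for c
  proof -
    have "restrict c {..<n} = F.lin_comb m t h \<longleftrightarrow> (\<forall>j<n. c j = (\<Oplus>i\<in>{..<m}. t i \<otimes> A i j))"
      if t: "t \<in> {..<m} \<rightarrow> carrier R" for t
    proof -
      have tm: "t i \<in> carrier R" if "i < m" for i using t that by auto
      have "F.lin_comb m t h j = (\<Oplus>i\<in>{..<m}. t i \<otimes> A i j)" if j: "j < n" for j
      proof -
        have "F.lin_comb m t h j = (\<Oplus>i\<in>{..<m}. (t i \<odot>\<^bsub>?F\<^esub> h i) j)"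
          unfolding F.lin_comb_def using tm hm j by (intro free_module_finsum_apply) auto
        also have "\<dots> = (\<Oplus>i\<in>{..<m}. t i \<otimes> A i j)"
          using tm app[OF hm] j by (intro R.finsum_cong') (auto simp: smult A_def)
        finally show ?thesis .
      qed
      moreover have "restrict c {..<n} = F.lin_comb m t h \<longleftrightarrow> (\<forall>j<n. c j = F.lin_comb m t h j)"
      proof (intro iffI allI impI)
        fix j assume "restrict c {..<n} = F.lin_comb m t h" and j: "j < n"
        from fun_cong[OF this(1), of j] show "c j = F.lin_comb m t h j" using j by simp
      qed (intro ext[OF mem[OF c] F.lin_comb_closed[OF t hF]], simp)
      ultimately show ?thesis by simp
    qed
    then show ?thesis unfolding row_span_def by blast
  qed
  have "\<exists>c\<in>{..<n} \<rightarrow> carrier R. x = lin_comb n c g" if "x \<in> carrier M" for x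
  proof -
    obtain v where "v \<in> carrier ?F" "x = f v" using \<open>x \<in> carrier M\<close> f(2) by auto
    then show ?thesis using f_eq app by (intro bexI[of _ v]) auto
  qed
  moreover have "lin_comb n c g = \<zero>\<^bsub>M\<^esub> \<longleftrightarrow> c \<in> row_span m n A"
    if c: "c \<in> {..<n} \<rightarrow> carrier R" for c
  proof -
    have "lin_comb n c g = f (restrict c {..<n})"
      unfolding f_eq[OF mem[OF c]] by (rule lin_comb_cong[symmetric]) (use c g in auto)
    then have "lin_comb n c g = \<zero>\<^bsub>M\<^esub> \<longleftrightarrow> restrict c {..<n} \<in> submodule_span R ?F (h ` {..<m})"
      using mem[OF c] X(3) h by auto
    also have "\<dots> \<longleftrightarrow> c \<in> row_span m n A"
      unfolding F.submodule_span_image[OF hF] using span[OF c] by auto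
    finally show ?thesis .
  qed
  ultimately have "presents m n g A" using g unfolding presents_def by blast
  then show thesis by (rule that[OF A])
qed

section \<open>The elementary divisor property and the concluding theorem\<close>

text \<open>Diagonalizing a relation matrix replaces the generators by independent ones, whose
  nonzero members span the cyclic summands.\<close>

theorem (in gcd_combination_ring) elementary_divisor_ring:
  "elementary_divisor_ring TYPE('m) R"
  unfolding elementary_divisor_ring_def
proof (intro conjI allI impI)
  show "cring R" by (rule is_cring)
  fix M :: "('a, 'm) module"
  assume fp: "finitely_presented R M"
  then interpret module R M by (simp add: finitely_presented_def)
  obtain m n g A where A: "carrier_mat A" "presents m n g A"
    using finitely_presented_presents[OF fp] .
  obtain B where B: "elem_equiv 0 m n A B" "\<forall>i\<in>{0..<m}. \<forall>j\<in>{0..<n}. i \<noteq> j \<longrightarrow> B i j = \<zero>"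
    using diagonal_reduction[OF A(1), of 0 m n] by (elim exE conjE)
  obtain g' where g': "presents m n g' B" using presents_elem_equiv[OF B(1) A] by auto
  have "independent n g'"
    using presents_diagonal_independent[OF g' elem_equiv_carrier_mat[OF B(1) A(1)]] B(2) by auto
  then show "\<exists>\<C>. (\<forall>N\<in>\<C>. cyclic_submodule R M N) \<and> is_direct_sum R M \<C>"
    using independent_generators_direct_sum[of g' n] g' unfolding presents_def by auto
qed

theorem corollary2p2:
  fixes R :: "('a, 'r) ring_scheme" (structure)
  assumes "cring R"
    and "arithmetic_ring R"
    and "Hausdorff_space (Max_topology R)"
    and "totally_disconnected_space (Max_topology R)"
  shows "elementary_divisor_ring TYPE('m) R \<and>
    (\<forall>a\<in>carrier R. \<forall>b\<in>carrier R.
       \<exists>d\<in>carrier R. \<exists>a'\<in>carrier R. \<exists>b'\<in>carrier R. \<exists>c\<in>carrier R.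
         a = a' \<otimes> d \<and> b = b' \<otimes> d \<and> a' \<oplus> c \<otimes> b' \<in> Units R)"
proof -
  interpret cring R by fact
  note unit_combination = arithmetic_unit_combination[OF assms(2-4)]
  have "\<exists>c\<in>carrier R. (a \<oplus> c \<otimes> b) divides b" if ab: "a \<in> carrier R" "b \<in> carrier R" for a b
  proof -
    obtain d a' b' c where carr: "d \<in> carrier R" "a' \<in> carrier R" "b' \<in> carrier R" "c \<in> carrier R"
      and eq: "a = a' \<otimes> d" "b = b' \<otimes> d" and unit: "a' \<oplus> c \<otimes> b' \<in> Units R"
      using unit_combination[OF ab] by auto
    let ?u = "a' \<oplus> c \<otimes> b'"
    \<comment> \<open>The combination is a unit times \<open>d\<close>, so it divides whatever
      \<open>d\<close> divides, in particular \<open>b\<close>.\<close>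
    have "a \<oplus> c \<otimes> b = ?u \<otimes> d" using carr eq by (simp add: l_distr m_assoc)
    moreover have "(?u \<otimes> d) \<otimes> (inv ?u \<otimes> b') = (?u \<otimes> inv ?u) \<otimes> (b' \<otimes> d)"
      using carr unit Units_inv_closed[OF unit] Units_closed[OF unit] by (simp add: m_ac)
    ultimately have "b = (a \<oplus> c \<otimes> b) \<otimes> (inv ?u \<otimes> b')"
      using carr eq(2) unit by simp
    then show ?thesis using carr Units_inv_closed[OF unit] by (intro bexI[of _ c] dividesI) auto
  qed
  then interpret gcd_combination_ring R by unfold_locales
  show ?thesis
    using elementary_divisor_ring unit_combination by (intro conjI ballI)
qed

end
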